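(* Let $E$ be an arbitrary directed graph, let $R$ be an associative unital ring, let $G$ be an arbitrary group, and equip the Leavitt path algebra $L_R(E)$ with an arbitrary standard $G$-gradation. Then $L_R(E)$ is nearly epsilon-strongly $G$-graded.
   Context: All rings are associative but not necessarily unital. Graphs. A directed graph $E=(E^0,E^1,r,s)$ consists of sets $E^0$ (vertices), $E^1$ (edges) and maps $r,s:E^1\to E^0$ (range, source). Leavitt path algebra. $L_R(E)$ is the (not necessarily unital) algebra with coefficients in $R$ generated by the sets $\{v\mid v\in E^0\}$, $\{f\mid f\in E^1\}$, $\{f^*\mid f\in E^1\}$, subject to: (1) $uv=\delta_{u,v}v$ for all $u,v\in E^0$; (2) $s(f)f=fr(f)=f$ and $r(f)f^*=f^*s(f)=f^*$ for all $f\in E^1$; (3) $f^*f'=\delta_{f,f'}r(f)$ for all $f,f'\in E^1$; (4) $\sum_{f\in E^1,\,s(f)=v}ff^*=v$ for every $v\in E^0$ for which $s^{-1}(v)$ is non-empty and finite. The elements of $R$ commute with the generators. Standard $G$-gradation. Let $G$ be a group with identity element $e$. Put $\deg(v)=e$ for each $v\in E^0$, and for each $f\in E^1$ choose some $g\in G$ (depending on $f$) and put $\deg(f)=g$, $\deg(f^* )=g^{-1}$. Since the relations (1)–(4) are homogeneous, any such choice induces a $G$-gradation on $L_R(E)$ (with elements of $R$ having degree $e$); any gradation obtained in this way is called a standard $G$-gradation. Graded rings. A ring $S$ is $G$-graded if $S=\bigoplus_{g\in G}S_g$ with $S_g$ additive subgroups and $S_gS_h\subseteq S_{gh}$ for all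 $g,h\in G$; products of additive subgroups denote the set of finite sums of products. s-unital bimodules. For rings $T,T'$, a $T$–$T'$-bimodule $M$ is s-unital if for each $m\in M$ there are $t\in T$ and $t'\in T'$ with $tm=m=mt'$. Nearly epsilon-strongly graded. A $G$-graded ring $S$ is nearly epsilon-strongly $G$-graded if for each $g\in G$ the $S_gS_{g^{-1}}$–$S_{g^{-1}}S_g$-bimodule $S_g$ is s-unital. *)

theory Defs
  imports "HOL-Algebra.QuotRing" "HOL-Algebra.Ideal_Product" "Graph_Theory.Digraph"
begin

section \<open>Rings without unit, bimodules, gradings\<close>

text \<open>Ring records always have a field \<open>one\<close>. It plays no role in the notions of this section:
  nothing below refers to it, and it need not lie in the carrier.\<close>

locale nonunital_ring = abelian_group S for S (structure) +
  assumes mult_closed: "\<lbrakk>x \<in> carrier S; y \<in> carrier S\<rbrakk> \<Longrightarrow> x \<otimes> y \<in> carrier S"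
    and mult_assoc: "\<lbrakk>x \<in> carrier S; y \<in> carrier S; z \<in> carrier S\<rbrakk>
      \<Longrightarrow> (x \<otimes> y) \<otimes> z = x \<otimes> (y \<otimes> z)"
    and distrib_right: "\<lbrakk>x \<in> carrier S; y \<in> carrier S; z \<in> carrier S\<rbrakk>
      \<Longrightarrow> (x \<oplus> y) \<otimes> z = x \<otimes> z \<oplus> y \<otimes> z"
    and distrib_left: "\<lbrakk>x \<in> carrier S; y \<in> carrier S; z \<in> carrier S\<rbrakk>
      \<Longrightarrow> x \<otimes> (y \<oplus> z) = x \<otimes> y \<oplus> x \<otimes> z"

locale ring_bimodule =
  T: nonunital_ring T + M: abelian_group M + U: nonunital_ring U
  for T :: "('t, 'tx) ring_scheme" and M :: "('m, 'mx) ring_scheme"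
    and U :: "('u, 'ux) ring_scheme"
    and lact :: "'t \<Rightarrow> 'm \<Rightarrow> 'm" (infixr \<open>\<triangleright>\<close> 75)
    and ract :: "'m \<Rightarrow> 'u \<Rightarrow> 'm" (infixl \<open>\<triangleleft>\<close> 75) +
  assumes lact_closed: "\<lbrakk>t \<in> carrier T; m \<in> carrier M\<rbrakk> \<Longrightarrow> t \<triangleright> m \<in> carrier M"
    and ract_closed: "\<lbrakk>m \<in> carrier M; u \<in> carrier U\<rbrakk> \<Longrightarrow> m \<triangleleft> u \<in> carrier M"
    and lact_add: "\<lbrakk>t \<in> carrier T; m \<in> carrier M; n \<in> carrier M\<rbrakk>
      \<Longrightarrow> t \<triangleright> (m \<oplus>\<^bsub>M\<^esub> n) = (t \<triangleright> m) \<oplus>\<^bsub>M\<^esub> (t \<triangleright> n)"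
    and add_lact: "\<lbrakk>t \<in> carrier T; t' \<in> carrier T; m \<in> carrier M\<rbrakk>
      \<Longrightarrow> (t \<oplus>\<^bsub>T\<^esub> t') \<triangleright> m = (t \<triangleright> m) \<oplus>\<^bsub>M\<^esub> (t' \<triangleright> m)"
    and mult_lact: "\<lbrakk>t \<in> carrier T; t' \<in> carrier T; m \<in> carrier M\<rbrakk>
      \<Longrightarrow> (t \<otimes>\<^bsub>T\<^esub> t') \<triangleright> m = t \<triangleright> (t' \<triangleright> m)"
    and add_ract: "\<lbrakk>m \<in> carrier M; n \<in> carrier M; u \<in> carrier U\<rbrakk>
      \<Longrightarrow> (m \<oplus>\<^bsub>M\<^esub> n) \<triangleleft> u = (m \<triangleleft> u) \<oplus>\<^bsub>M\<^esub> (n \<triangleleft> u)"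
    and ract_add: "\<lbrakk>m \<in> carrier M; u \<in> carrier U; u' \<in> carrier U\<rbrakk>
      \<Longrightarrow> m \<triangleleft> (u \<oplus>\<^bsub>U\<^esub> u') = (m \<triangleleft> u) \<oplus>\<^bsub>M\<^esub> (m \<triangleleft> u')"
    and ract_mult: "\<lbrakk>m \<in> carrier M; u \<in> carrier U; u' \<in> carrier U\<rbrakk>
      \<Longrightarrow> m \<triangleleft> (u \<otimes>\<^bsub>U\<^esub> u') = (m \<triangleleft> u) \<triangleleft> u'"
    and lact_ract: "\<lbrakk>t \<in> carrier T; m \<in> carrier M; u \<in> carrier U\<rbrakk>
      \<Longrightarrow> (t \<triangleright> m) \<triangleleft> u = t \<triangleright> (m \<triangleleft> u)"

locale s_unital_bimodule = ring_bimodule +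
  assumes s_unital_left: "m \<in> carrier M \<Longrightarrow> \<exists>t \<in> carrier T. t \<triangleright> m = m"
    and s_unital_right: "m \<in> carrier M \<Longrightarrow> \<exists>u \<in> carrier U. m \<triangleleft> u = m"

text \<open>The library's \<open>ideal_prod\<close> (infix \<open>\<cdot>\<close>) of two subsets is the set of all nonempty finite
  sums of products, so it is also the product of additive subgroups.\<close>

locale graded_ring = S: nonunital_ring S + G: group G
  for S :: "('a, 'ax) ring_scheme" and G :: "('g, 'gx) monoid_scheme" and A :: "'g \<Rightarrow> 'a set" +
  assumes component_subgroup: "g \<in> carrier G \<Longrightarrow> additive_subgroup (A g) S"
    and direct_sum: "x \<in> carrier S \<Longrightarrow>
      \<exists>!c. c \<in> (\<Pi>\<^sub>E g \<in> carrier G. A g) \<and> finite {g \<in> carrier G. c g \<noteq> \<zero>\<^bsub>S\<^esub>} \<and>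
           x = (\<Oplus>\<^bsub>S\<^esub> g \<in> {g \<in> carrier G. c g \<noteq> \<zero>\<^bsub>S\<^esub>}. c g)"
    and component_mult: "\<lbrakk>g \<in> carrier G; h \<in> carrier G\<rbrakk>
      \<Longrightarrow> A g \<cdot>\<^bsub>S\<^esub> A h \<subseteq> A (g \<otimes>\<^bsub>G\<^esub> h)"

locale nearly_epsilon_strongly_graded = graded_ring S G A
  for S :: "('a, 'ax) ring_scheme" and G :: "('g, 'gx) monoid_scheme" and A :: "'g \<Rightarrow> 'a set" +
  assumes component_s_unital: "g \<in> carrier G \<Longrightarrow>
    s_unital_bimodule
      (S\<lparr>carrier := A g \<cdot>\<^bsub>S\<^esub> A (inv\<^bsub>G\<^esub> g)\<rparr>)
      (S\<lparr>carrier := A g\<rparr>)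
      (S\<lparr>carrier := A (inv\<^bsub>G\<^esub> g) \<cdot>\<^bsub>S\<^esub> A g\<rparr>)
      (mult S) (mult S)"


section \<open>Free algebras\<close>

text \<open>The free unital \<open>R\<close>-ring on a set \<open>X\<close> of symbols commuting with \<open>R\<close>: finitely supported
  functions from words over \<open>X\<close> to the possibly noncommutative ring \<open>R\<close>, with convolution.\<close>

definition word_monom :: "('r, 'm) ring_scheme \<Rightarrow> 'x list \<Rightarrow> 'x list \<Rightarrow> 'r" where
  "word_monom R w = (\<lambda>u. if u = w then \<one>\<^bsub>R\<^esub> else \<zero>\<^bsub>R\<^esub>)"

definition free_algebra :: "('r, 'm) ring_scheme \<Rightarrow> 'x set \<Rightarrow> ('x list \<Rightarrow> 'r) ring" where
  "free_algebra R X =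
    \<lparr>carrier = {a. (\<forall>w. a w \<in> carrier R) \<and> finite {w. a w \<noteq> \<zero>\<^bsub>R\<^esub>} \<and>
                   {w. a w \<noteq> \<zero>\<^bsub>R\<^esub>} \<subseteq> lists X},
     mult = (\<lambda>a b w. \<Oplus>\<^bsub>R\<^esub> i \<in> {..length w}. a (take i w) \<otimes>\<^bsub>R\<^esub> b (drop i w)),
     one = word_monom R [],
     zero = (\<lambda>w. \<zero>\<^bsub>R\<^esub>),
     add = (\<lambda>a b w. a w \<oplus>\<^bsub>R\<^esub> b w)\<rparr>"

text \<open>The free nonunital algebra is spanned by the nonempty words.\<close>

definition nonunital_part :: "('r, 'm) ring_scheme \<Rightarrow> 'x set \<Rightarrow> ('x list \<Rightarrow> 'r) set" where
  "nonunital_part R X = {a \<in> carrier (free_algebra R X). a [] = \<zero>\<^bsub>R\<^esub>}"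


section \<open>Leavitt path algebras\<close>

text \<open>The source and range maps of the graph \<open>E\<close> are \<open>tail E\<close> and \<open>head E\<close>;
  \<open>Ghost f\<close> stands for \<open>f\<^sup>*\<close>.\<close>

datatype ('v, 'e) lpa_gen = Vertex 'v | Edge 'e | Ghost 'e

definition lpa_gens :: "('v, 'e) pre_digraph \<Rightarrow> ('v, 'e) lpa_gen set" where
  "lpa_gens E = Vertex ` verts E \<union> Edge ` arcs E \<union> Ghost ` arcs E"

abbreviation lpa_free ::
  "('r, 'm) ring_scheme \<Rightarrow> ('v, 'e) pre_digraph \<Rightarrow> (('v, 'e) lpa_gen list \<Rightarrow> 'r) ring" where
  "lpa_free R E \<equiv> free_algebra R (lpa_gens E)"

definition lpa_relators ::
  "('r, 'm) ring_scheme \<Rightarrow> ('v, 'e) pre_digraph \<Rightarrow> (('v, 'e) lpa_gen list \<Rightarrow> 'r) set" where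
  "lpa_relators R E =
    (let F = lpa_free R E; m = word_monom R in
      {m [Vertex u, Vertex v] \<ominus>\<^bsub>F\<^esub> (if u = v then m [Vertex v] else \<zero>\<^bsub>F\<^esub>)
         | u v. u \<in> verts E \<and> v \<in> verts E}
    \<union> {m [Vertex (tail E f), Edge f] \<ominus>\<^bsub>F\<^esub> m [Edge f] | f. f \<in> arcs E}
    \<union> {m [Edge f, Vertex (head E f)] \<ominus>\<^bsub>F\<^esub> m [Edge f] | f. f \<in> arcs E}
    \<union> {m [Vertex (head E f), Ghost f] \<ominus>\<^bsub>F\<^esub> m [Ghost f] | f. f \<in> arcs E}
    \<union> {m [Ghost f, Vertex (tail E f)] \<ominus>\<^bsub>F\<^esub> m [Ghost f] | f. f \<in> arcs E}
    \<union> {m [Ghost f, Edge f'] \<ominus>\<^bsub>F\<^esub> (if f = f' then m [Vertex (head E f)] else \<zero>\<^bsub>F\<^esub>)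
         | f f'. f \<in> arcs E \<and> f' \<in> arcs E}
    \<union> {(\<Oplus>\<^bsub>F\<^esub> f \<in> out_arcs E v. m [Edge f, Ghost f]) \<ominus>\<^bsub>F\<^esub> m [Vertex v]
         | v. v \<in> verts E \<and> out_arcs E v \<noteq> {} \<and> finite (out_arcs E v)})"

definition lpa_ideal ::
  "('r, 'm) ring_scheme \<Rightarrow> ('v, 'e) pre_digraph \<Rightarrow> (('v, 'e) lpa_gen list \<Rightarrow> 'r) set" where
  "lpa_ideal R E = Idl\<^bsub>lpa_free R E\<^esub> (lpa_relators R E)"

text \<open>The relators lie in the nonunital part, which is an ideal of the unital free algebra. Hence
  the ideal they generate in the unital free algebra is contained in the nonunital part, and it is
  the ideal, closed under the coefficients, that they generate there. The quotient of the nonunital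
  part by it is the Leavitt path algebra, here realized as a subset of the quotient of the unital
  free algebra; the field \<open>one\<close> inherited from the latter is in general not in the carrier.\<close>

definition leavitt_path_algebra ::
  "('r, 'm) ring_scheme \<Rightarrow> ('v, 'e) pre_digraph \<Rightarrow> (('v, 'e) lpa_gen list \<Rightarrow> 'r) set ring" where
  "leavitt_path_algebra R E =
    (lpa_free R E Quot lpa_ideal R E)
      \<lparr>carrier := (\<lambda>a. lpa_ideal R E +>\<^bsub>lpa_free R E\<^esub> a) ` nonunital_part R (lpa_gens E)\<rparr>"


section \<open>Standard gradations\<close>

fun gen_degree :: "('g, 'n) monoid_scheme \<Rightarrow> ('e \<Rightarrow> 'g) \<Rightarrow> ('v, 'e) lpa_gen \<Rightarrow> 'g" where
  "gen_degree G d (Vertex v) = \<one>\<^bsub>G\<^esub>"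
| "gen_degree G d (Edge f) = d f"
| "gen_degree G d (Ghost f) = inv\<^bsub>G\<^esub> (d f)"

definition word_degree :: "('g, 'n) monoid_scheme \<Rightarrow> ('e \<Rightarrow> 'g) \<Rightarrow> ('v, 'e) lpa_gen list \<Rightarrow> 'g" where
  "word_degree G d w = foldr (\<lambda>x h. gen_degree G d x \<otimes>\<^bsub>G\<^esub> h) w \<one>\<^bsub>G\<^esub>"

text \<open>The component of degree \<open>g\<close> consists of the classes of the \<open>R\<close>-linear combinations of nonempty
  words of degree \<open>g\<close>.\<close>

definition standard_gradation ::
  "('r, 'm) ring_scheme \<Rightarrow> ('v, 'e) pre_digraph \<Rightarrow> ('g, 'n) monoid_scheme \<Rightarrow> ('e \<Rightarrow> 'g)
    \<Rightarrow> 'g \<Rightarrow> (('v, 'e) lpa_gen list \<Rightarrow> 'r) set set" where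
  "standard_gradation R E G d g =
    (\<lambda>a. lpa_ideal R E +>\<^bsub>lpa_free R E\<^esub> a) `
      {a \<in> nonunital_part R (lpa_gens E). \<forall>w. a w \<noteq> \<zero>\<^bsub>R\<^esub> \<longrightarrow> word_degree G d w = g}"

end

theory Submission
  imports Defs
begin

text \<open>Every word \<open>w\<close> in the generators of a Leavitt path algebra is a partial isometry: reversing \<open>w\<close> and
exchanging edges with ghost edges gives a word \<open>w\<^sup>*\<close> with \<open>w w\<^sup>* w = w\<close>. If \<open>w\<close> is nonempty of degree \<open>g\<close>, then
\<open>w\<^sup>*\<close> has degree \<open>g\<close> inverse, so the idempotent \<open>p = w w\<^sup>*\<close> lies in the product of the components of
degree \<open>g\<close> and \<open>g\<close> inverse, and it is a left unit for \<open>w\<close>. Since coefficients commute with words, a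
common left unit for the finitely many words of a homogeneous element is a left unit for that element.
Such a common unit is found as the join of the idempotents \<open>w w\<^sup>*\<close>: for commuting idempotents,
\<open>e + f - e f\<close> is a unit for both \<open>e\<close> and \<open>f\<close> (\<open>join_of_commuting_idempotents\<close>). Right units come from
the same statement applied to the words \<open>w\<^sup>*\<close>.

That the idempotents \<open>w w\<^sup>*\<close> commute and that \<open>w w\<^sup>* w = w\<close> are proved together, without a normal form
for words. The set \<open>projections\<close> is the closure of the vertices and zero under \<open>e \<mapsto> f e f\<^sup>*\<close>, so its
nonzero elements are the \<open>\<alpha> \<alpha>\<^sup>*\<close> for paths \<open>\<alpha>\<close>. Its elements commute (\<open>projections_commute\<close>),
and it is closed under \<open>e \<mapsto> x e x\<^sup>*\<close> for every generator \<open>x\<close> (\<open>conj_projection\<close>); by induction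
on \<open>w\<close> it contains all \<open>w w\<^sup>*\<close>, and commuting \<open>x\<^sup>* x\<close> past \<open>w w\<^sup>*\<close> gives the induction step for
\<open>w w\<^sup>* w = w\<close>.

The other half of the claim is that the components really form a gradation. The relators are
homogeneous, so the ideal that they generate contains the homogeneous parts of its elements
(\<open>lpa_ideal_homogeneous\<close>). Taking homogeneous parts therefore descends to the quotient, and the
resulting additive projections onto the components yield existence and uniqueness of decompositions
(\<open>graded_ring_if_projections\<close>). For this the free algebra must first be shown to be a ring.\<close>

section \<open>Rings without unit\<close>

lemma (in abelian_group) additive_subgroup_intro:
  assumes "H \<subseteq> carrier G" "\<zero> \<in> H"
    and "\<And>x y. x \<in> H \<Longrightarrow> y \<in> H \<Longrightarrow> x \<oplus> y \<in> H"
    and "\<And>x. x \<in> H \<Longrightarrow> \<ominus> x \<in> H"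
  shows "additive_subgroup H G"
  using assms by (intro additive_subgroup.intro subgroup.intro) (auto simp: a_inv_def)

lemma (in abelian_group) additive_subgroupD:
  assumes "additive_subgroup H G"
  shows "H \<subseteq> carrier G" "\<zero> \<in> H"
    and "\<And>x y. x \<in> H \<Longrightarrow> y \<in> H \<Longrightarrow> x \<oplus> y \<in> H"
    and "\<And>x. x \<in> H \<Longrightarrow> \<ominus> x \<in> H"
  using assms additive_subgroup.a_subset additive_subgroup.zero_closed additive_subgroup.a_closed
    subgroup.m_inv_closed[OF additive_subgroup.a_subgroup, of H G]
  by (auto simp: a_inv_def)

lemma (in abelian_group) minus_eq_zero_iff:
  assumes "x \<in> carrier G" "y \<in> carrier G"
  shows "x \<ominus> y = \<zero> \<longleftrightarrow> x = y"
  using assms minus_equality[of x "\<ominus> y"] by (auto simp: a_minus_def r_neg)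

lemma (in abelian_group) abelian_group_carrier_update:
  assumes "additive_subgroup H G"
  shows "abelian_group (G\<lparr>carrier := H\<rparr>)"
proof -
  note H = additive_subgroupD[OF assms]
  have inv: "\<exists>y\<in>H. y \<oplus> x = \<zero>" if "x \<in> H" for x
    using H that l_neg by (metis subsetD)
  show ?thesis
    by (rule abelian_groupI) (use H inv in \<open>auto simp: a_ac subset_iff\<close>)
qed

lemma (in abelian_group) additive_subgroup_carrier_update:
  assumes C: "additive_subgroup C G" and H: "additive_subgroup H G" and "H \<subseteq> C"
  shows "additive_subgroup H (G\<lparr>carrier := C\<rparr>)"
proof -
  interpret C: abelian_group "G\<lparr>carrier := C\<rparr>"
    by (rule abelian_group_carrier_update[OF C])
  note C' = additive_subgroupD[OF C] and H' = additive_subgroupD[OF H]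
  have minus: "\<ominus>\<^bsub>G\<lparr>carrier := C\<rparr>\<^esub> x = \<ominus> x" if "x \<in> H" for x
    using C.minus_equality[of "\<ominus> x" x] that \<open>H \<subseteq> C\<close> C' H' by (auto simp: l_neg subset_iff)
  show ?thesis
    by (rule C.additive_subgroup_intro) (use H' \<open>H \<subseteq> C\<close> minus in auto)
qed

lemma (in ring) nonunital_ring: "nonunital_ring R"
  by unfold_locales (simp_all add: m_assoc l_distr r_distr)

lemma (in nonunital_ring) nonunital_ring_carrier_update:
  assumes "additive_subgroup H S" and "\<And>x y. x \<in> H \<Longrightarrow> y \<in> H \<Longrightarrow> x \<otimes> y \<in> H"
  shows "nonunital_ring (S\<lparr>carrier := H\<rparr>)"
proof -
  interpret H: abelian_group "S\<lparr>carrier := H\<rparr>"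
    by (rule abelian_group_carrier_update[OF assms(1)])
  show ?thesis
    by unfold_locales
      (use assms(2) additive_subgroupD(1)[OF assms(1)] in
        \<open>auto simp: mult_assoc distrib_left distrib_right subset_iff\<close>)
qed

lemma (in nonunital_ring) mult_zero:
  assumes "x \<in> carrier S"
  shows "x \<otimes> \<zero> = \<zero>" and "\<zero> \<otimes> x = \<zero>"
proof -
  have "x \<otimes> \<zero> \<oplus> x \<otimes> \<zero> = x \<otimes> \<zero> \<oplus> \<zero>"
    using assms distrib_left[of x \<zero> \<zero>] by (simp add: mult_closed)
  then show "x \<otimes> \<zero> = \<zero>" using assms by (simp add: mult_closed)
  have "\<zero> \<otimes> x \<oplus> \<zero> \<otimes> x = \<zero> \<otimes> x \<oplus> \<zero>"
    using assms distrib_right[of \<zero> \<zero> x] by (simp add: mult_closed)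
  then show "\<zero> \<otimes> x = \<zero>" using assms by (simp add: mult_closed)
qed

lemma (in nonunital_ring) minus_mult:
  assumes "x \<in> carrier S" "y \<in> carrier S"
  shows "\<ominus> (x \<otimes> y) = \<ominus> x \<otimes> y"
proof (rule minus_equality)
  show "\<ominus> x \<otimes> y \<oplus> x \<otimes> y = \<zero>"
    using assms distrib_right[of "\<ominus> x" x y] by (simp add: l_neg mult_zero)
qed (use assms in \<open>auto simp: mult_closed\<close>)

lemma (in nonunital_ring) mult_minus:
  assumes "x \<in> carrier S" "y \<in> carrier S"
  shows "\<ominus> (x \<otimes> y) = x \<otimes> \<ominus> y"
proof (rule minus_equality)
  show "x \<otimes> \<ominus> y \<oplus> x \<otimes> y = \<zero>"
    using assms distrib_left[of x "\<ominus> y" y] by (simp add: l_neg mult_zero)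
qed (use assms in \<open>auto simp: mult_closed\<close>)

lemma (in nonunital_ring) ideal_prod_subgroup:
  assumes "additive_subgroup I S" "additive_subgroup J S"
  shows "additive_subgroup (I \<cdot> J) S"
proof -
  note I = additive_subgroupD[OF assms(1)] and J = additive_subgroupD[OF assms(2)]
  have sub: "x \<in> carrier S" if "x \<in> I \<cdot> J" for x
    using that by induction (use I J in \<open>auto simp: mult_closed subset_iff\<close>)
  show ?thesis
  proof (rule additive_subgroup_intro)
    show "\<zero> \<in> I \<cdot> J"
      using ideal_prod.prod[of \<zero> I \<zero> J S] I J by (simp add: mult_zero)
    show "\<ominus> x \<in> I \<cdot> J" if "x \<in> I \<cdot> J" for x
      using that
    proof induction
      case (prod i j)
      then show ?case
        using minus_mult[of i j] I J ideal_prod.prod[of "\<ominus> i" I j J S] by (simp add: subset_iff)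
    next
      case (sum s1 s2)
      then show ?case
        using ideal_prod.sum[of "\<ominus> s1" S I J "\<ominus> s2"] sub by (simp add: minus_add)
    qed
  qed (use sub in \<open>auto intro: ideal_prod.sum\<close>)
qed

text \<open>The join of commuting idempotents: \<open>t + e - e t\<close> extends a unit \<open>t\<close> of the earlier idempotents
to the new one \<open>e\<close>. That \<open>e\<close> commutes with \<open>t\<close> has to be carried through the induction, and it is
recorded as the stronger property that \<open>t\<close> commutes with whatever commutes with all given
idempotents.\<close>

lemma (in nonunital_ring) join_of_commuting_idempotents:
  assumes T: "additive_subgroup T S" "\<And>x y. x \<in> T \<Longrightarrow> y \<in> T \<Longrightarrow> x \<otimes> y \<in> T"
    and "finite P" "P \<subseteq> T"
    and "\<And>p. p \<in> P \<Longrightarrow> p \<otimes> p = p" "\<And>p p'. p \<in> P \<Longrightarrow> p' \<in> P \<Longrightarrow> p \<otimes> p' = p' \<otimes> p"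
  shows "\<exists>t\<in>T. \<forall>p\<in>P. t \<otimes> p = p \<and> p \<otimes> t = p"
proof -
  note T' = additive_subgroupD[OF T(1)]
  have "\<exists>t\<in>T. (\<forall>p\<in>P. t \<otimes> p = p \<and> p \<otimes> t = p) \<and>
      (\<forall>y\<in>carrier S. (\<forall>p\<in>P. y \<otimes> p = p \<otimes> y) \<longrightarrow> y \<otimes> t = t \<otimes> y)"
    using assms(3-)
  proof (induction P)
    case empty
    then show ?case using T'(2) by (auto intro!: bexI[of _ \<zero>] simp: mult_zero)
  next
    case (insert e P)
    then obtain t where t: "t \<in> T" and unit: "\<And>p. p \<in> P \<Longrightarrow> t \<otimes> p = p \<and> p \<otimes> t = p"
      and comm: "\<And>y. y \<in> carrier S \<Longrightarrow> (\<And>p. p \<in> P \<Longrightarrow> y \<otimes> p = p \<otimes> y) \<Longrightarrow> y \<otimes> t = t \<otimes> y"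
      by auto
    have car: "t \<in> carrier S" "e \<in> carrier S" "\<And>p. p \<in> P \<Longrightarrow> p \<in> carrier S"
      using t insert.prems T' by auto
    have ee: "e \<otimes> e = e" and et: "e \<otimes> t = t \<otimes> e" and eT: "e \<in> T"
      using insert.prems comm[OF car(2)] by auto
    have ep: "e \<otimes> p = p \<otimes> e" if "p \<in> P" for p using insert.prems that by auto
    let ?s = "t \<oplus> (e \<oplus> \<ominus> (e \<otimes> t))"
    have sT: "?s \<in> T" using t eT T' T(2) by auto
    have left: "?s \<otimes> y = t \<otimes> y \<oplus> (e \<otimes> y \<oplus> \<ominus> (e \<otimes> (t \<otimes> y)))"
      and right: "y \<otimes> ?s = y \<otimes> t \<oplus> (y \<otimes> e \<oplus> \<ominus> (y \<otimes> e \<otimes> t))" if "y \<in> carrier S" for y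
      using that car
      by (simp_all add: distrib_right distrib_left minus_mult[symmetric] mult_minus[symmetric]
          mult_closed mult_assoc)
    have "?s \<otimes> p = p \<and> p \<otimes> ?s = p" if "p \<in> insert e P" for p
    proof (cases "p = e")
      case True
      have "e \<otimes> (t \<otimes> e) = t \<otimes> e" using ee car by (metis et mult_assoc)
      then show ?thesis
        using True car ee et left[of e] right[of e]
        by (simp add: mult_closed r_neg a_lcomm[of "t \<otimes> e"])
    next
      case False
      then have p: "p \<in> P" "p \<in> carrier S" using that car by auto
      have "p \<otimes> e \<otimes> t = e \<otimes> p"
        using unit[OF p(1)] p car by (simp add: ep[OF p(1), symmetric] mult_assoc)
      then show ?thesis
        using p car unit[OF p(1)] ep[OF p(1)] left[of p] right[of p] by (simp add: mult_closed r_neg)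
    qed
    moreover have "y \<otimes> ?s = ?s \<otimes> y"
      if y: "y \<in> carrier S" "\<And>p. p \<in> insert e P \<Longrightarrow> y \<otimes> p = p \<otimes> y" for y
    proof -
      have "y \<otimes> t = t \<otimes> y" "y \<otimes> e = e \<otimes> y" using y comm by auto
      then show ?thesis using left[OF y(1)] right[OF y(1)] y(1) car by (simp add: mult_assoc)
    qed
    ultimately show ?case using sT by (intro bexI[of _ ?s]) auto
  qed
  then show ?thesis by blast
qed

section \<open>Graded rings\<close>

context graded_ring
begin

lemma component_multD:
  assumes "x \<in> A g" "y \<in> A h" "g \<in> carrier G" "h \<in> carrier G"
  shows "x \<otimes>\<^bsub>S\<^esub> y \<in> A (g \<otimes>\<^bsub>G\<^esub> h)"
  using component_mult[OF assms(3,4)] ideal_prod.prod[OF assms(1,2), of S] by blast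

lemma component_subset: "g \<in> carrier G \<Longrightarrow> A g \<subseteq> carrier S"
  using S.additive_subgroupD(1)[OF component_subgroup] .

text \<open>In \<open>(a b) (c d)\<close> with \<open>a\<close>, \<open>c\<close> of degree \<open>g\<close> and \<open>b\<close>, \<open>d\<close> of inverse degree, the factor \<open>b c d\<close> has the
degree of \<open>b\<close>.\<close>

lemma component_prod_mult_closed:
  assumes g: "g \<in> carrier G"
    and x: "x \<in> A g \<cdot>\<^bsub>S\<^esub> A (inv\<^bsub>G\<^esub> g)" and y: "y \<in> A g \<cdot>\<^bsub>S\<^esub> A (inv\<^bsub>G\<^esub> g)"
  shows "x \<otimes>\<^bsub>S\<^esub> y \<in> A g \<cdot>\<^bsub>S\<^esub> A (inv\<^bsub>G\<^esub> g)"
proof -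
  let ?B = "A g \<cdot>\<^bsub>S\<^esub> A (inv\<^bsub>G\<^esub> g)"
  have gi: "inv\<^bsub>G\<^esub> g \<in> carrier G" using g by simp
  have B: "additive_subgroup ?B S"
    by (intro S.ideal_prod_subgroup component_subgroup g gi)
  note B = S.additive_subgroupD[OF B]
  have yA: "y \<in> A \<one>\<^bsub>G\<^esub>"
    using y component_mult[OF g gi] g by auto
  show ?thesis
    using x
  proof induction
    case (prod i j)
    have ij: "i \<in> carrier S" "j \<in> carrier S"
      using prod component_subset g gi by auto
    have "j \<otimes>\<^bsub>S\<^esub> y \<in> A (inv\<^bsub>G\<^esub> g)"
      using component_multD[OF prod(2) yA gi] gi by simp
    then have "i \<otimes>\<^bsub>S\<^esub> (j \<otimes>\<^bsub>S\<^esub> y) \<in> ?B" using prod(1) by (rule ideal_prod.prod[rotated])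
    then show ?case using ij y B(1) by (simp add: S.mult_assoc subset_iff)
  next
    case (sum s1 s2)
    then show ?case using y B(1) S.distrib_right[of s1 s2 y] ideal_prod.sum by (metis subsetD)
  qed
qed

lemma component_bimodule:
  assumes g: "g \<in> carrier G"
  shows "ring_bimodule
      (S\<lparr>carrier := A g \<cdot>\<^bsub>S\<^esub> A (inv\<^bsub>G\<^esub> g)\<rparr>)
      (S\<lparr>carrier := A g\<rparr>)
      (S\<lparr>carrier := A (inv\<^bsub>G\<^esub> g) \<cdot>\<^bsub>S\<^esub> A g\<rparr>)
      (mult S) (mult S)"
proof -
  let ?T = "A g \<cdot>\<^bsub>S\<^esub> A (inv\<^bsub>G\<^esub> g)" and ?U = "A (inv\<^bsub>G\<^esub> g) \<cdot>\<^bsub>S\<^esub> A g"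
  have gi: "inv\<^bsub>G\<^esub> g \<in> carrier G" using g by simp
  have T: "additive_subgroup ?T S" and U: "additive_subgroup ?U S"
    by (intro S.ideal_prod_subgroup component_subgroup g gi)+
  have "nonunital_ring (S\<lparr>carrier := ?T\<rparr>)"
    using T component_prod_mult_closed[OF g] by (rule S.nonunital_ring_carrier_update)
  moreover have "nonunital_ring (S\<lparr>carrier := ?U\<rparr>)"
    using U component_prod_mult_closed[OF gi] g
    by (intro S.nonunital_ring_carrier_update) simp_all
  moreover have "abelian_group (S\<lparr>carrier := A g\<rparr>)"
    by (rule S.abelian_group_carrier_update[OF component_subgroup[OF g]])
  moreover have TA: "t \<otimes>\<^bsub>S\<^esub> m \<in> A g" if "t \<in> ?T" "m \<in> A g" for t m
    using component_multD[of t "\<one>\<^bsub>G\<^esub>" m g] component_mult[OF g gi] that g by auto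
  moreover have AU: "m \<otimes>\<^bsub>S\<^esub> u \<in> A g" if "m \<in> A g" "u \<in> ?U" for u m
    using component_multD[of m g u "\<one>\<^bsub>G\<^esub>"] component_mult[OF gi g] that g by auto
  moreover have "x \<in> carrier S" if "x \<in> ?T \<or> x \<in> ?U \<or> x \<in> A g" for x
    using that S.additive_subgroupD(1)[OF T] S.additive_subgroupD(1)[OF U] component_subset[OF g]
    by blast
  ultimately show ?thesis
    by (intro ring_bimodule.intro ring_bimodule_axioms.intro)
      (simp_all add: S.mult_assoc S.distrib_left S.distrib_right)
qed

text \<open>The bimodule axioms hold in every graded ring, so only the local units remain to be provided.\<close>

lemma nearly_epsilon_strongly_gradedI:
  assumes "\<And>g m. g \<in> carrier G \<Longrightarrow> m \<in> A g \<Longrightarrow> \<exists>t \<in> A g \<cdot>\<^bsub>S\<^esub> A (inv\<^bsub>G\<^esub> g). t \<otimes>\<^bsub>S\<^esub> m = m"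
    and "\<And>g m. g \<in> carrier G \<Longrightarrow> m \<in> A g \<Longrightarrow> \<exists>u \<in> A (inv\<^bsub>G\<^esub> g) \<cdot>\<^bsub>S\<^esub> A g. m \<otimes>\<^bsub>S\<^esub> u = m"
  shows "nearly_epsilon_strongly_graded S G A"
  by (intro nearly_epsilon_strongly_graded.intro nearly_epsilon_strongly_graded_axioms.intro
      graded_ring_axioms s_unital_bimodule.intro s_unital_bimodule_axioms.intro component_bimodule)
    (simp_all add: assms)

end

text \<open>Additive projections determine all coefficients of a decomposition: applying \<open>\<pi> g\<close> to a finite sum of
elements of the components leaves the summand in degree \<open>g\<close>. This gives uniqueness, and it shows that
the finite set in the last premise contains the support of \<open>g \<mapsto> \<pi> g x\<close>.\<close>

lemma graded_ring_if_projections: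
  fixes S (structure) and G :: "('g, 'gx) monoid_scheme"
  assumes "nonunital_ring S" "group G"
    and sub: "\<And>g. g \<in> carrier G \<Longrightarrow> additive_subgroup (A g) S"
    and mult: "\<And>g h x y. g \<in> carrier G \<Longrightarrow> h \<in> carrier G \<Longrightarrow> x \<in> A g \<Longrightarrow> y \<in> A h
      \<Longrightarrow> x \<otimes> y \<in> A (g \<otimes>\<^bsub>G\<^esub> h)"
    and proj_in: "\<And>g x. g \<in> carrier G \<Longrightarrow> x \<in> carrier S \<Longrightarrow> \<pi> g x \<in> A g"
    and proj_add: "\<And>g x y. g \<in> carrier G \<Longrightarrow> x \<in> carrier S \<Longrightarrow> y \<in> carrier S
      \<Longrightarrow> \<pi> g (x \<oplus> y) = \<pi> g x \<oplus> \<pi> g y"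
    and proj_same: "\<And>g x. g \<in> carrier G \<Longrightarrow> x \<in> A g \<Longrightarrow> \<pi> g x = x"
    and proj_other: "\<And>g h x. g \<in> carrier G \<Longrightarrow> h \<in> carrier G \<Longrightarrow> g \<noteq> h \<Longrightarrow> x \<in> A h
      \<Longrightarrow> \<pi> g x = \<zero>"
    and proj_sum: "\<And>x. x \<in> carrier S
      \<Longrightarrow> \<exists>K. finite K \<and> K \<subseteq> carrier G \<and> x = (\<Oplus>g\<in>K. \<pi> g x)"
  shows "graded_ring S G A"
proof -
  interpret S: nonunital_ring S by fact
  interpret G: group G by fact
  have subset: "A g \<subseteq> carrier S" if "g \<in> carrier G" for g
    using S.additive_subgroupD(1)[OF sub[OF that]] .
  have proj_zero: "\<pi> g \<zero> = \<zero>" if "g \<in> carrier G" for g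
    using proj_same[OF that] S.additive_subgroupD(2)[OF sub[OF that]] by simp
  have proj_finsum: "\<pi> g (\<Oplus>h\<in>K. c h) = (if g \<in> K then c g else \<zero>)"
    if "finite K" "K \<subseteq> carrier G" "\<And>h. h \<in> K \<Longrightarrow> c h \<in> A h" "g \<in> carrier G" for g K c
    using that
  proof (induction K)
    case (insert k K)
    have "c k \<in> carrier S" "c \<in> K \<rightarrow> carrier S"
      using insert.prems subset by auto
    moreover have "g \<in> insert k K \<Longrightarrow> c g \<in> carrier S"
      using insert.prems subset by auto
    ultimately show ?case
      using insert proj_add[of g "c k" "\<Oplus>h\<in>K. c h"] proj_same[of g "c g"]
        proj_other[of g k "c k"]
      by (cases "g = k"; cases "g \<in> K") (auto simp: S.finsum_insert)
  qed (simp add: proj_zero)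
  have decomp: "\<exists>!c. c \<in> (\<Pi>\<^sub>E g \<in> carrier G. A g) \<and> finite {g \<in> carrier G. c g \<noteq> \<zero>} \<and>
           x = (\<Oplus>g \<in> {g \<in> carrier G. c g \<noteq> \<zero>}. c g)" if x: "x \<in> carrier S" for x
  proof (rule ex1I)
    let ?c = "\<lambda>g\<in>carrier G. \<pi> g x"
    let ?N = "{g \<in> carrier G. ?c g \<noteq> \<zero>}"
    obtain K where K: "finite K" "K \<subseteq> carrier G" and xK: "x = (\<Oplus>g\<in>K. \<pi> g x)"
      using proj_sum[OF x] by blast
    have N: "?N \<subseteq> K"
    proof
      fix g assume "g \<in> ?N"
      then show "g \<in> K"
        using proj_finsum[OF K, of "\<lambda>g. \<pi> g x" g] xK proj_in x K(2)
        by (auto split: if_splits simp: subset_iff)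
    qed
    have "(\<Oplus>g\<in>?N. ?c g) = (\<Oplus>g\<in>K. \<pi> g x)"
      by (rule S.add.finprod_mono_neutral_cong_left[OF K(1) N])
        (use K proj_in[OF _ x] subset in auto)
    then have "x = (\<Oplus>g\<in>?N. ?c g)" using xK by simp
    moreover have "?c \<in> (\<Pi>\<^sub>E g \<in> carrier G. A g)" using proj_in[OF _ x] by auto
    ultimately show "?c \<in> (\<Pi>\<^sub>E g \<in> carrier G. A g) \<and> finite ?N \<and> x = (\<Oplus>g\<in>?N. ?c g)"
      using finite_subset[OF N K(1)] by blast
  next
    fix c
    let ?N = "{g \<in> carrier G. c g \<noteq> \<zero>}"
    assume c: "c \<in> (\<Pi>\<^sub>E g \<in> carrier G. A g) \<and> finite ?N \<and> x = (\<Oplus>g\<in>?N. c g)"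
    show "c = (\<lambda>g\<in>carrier G. \<pi> g x)"
    proof (rule PiE_ext)
      show "c \<in> (\<Pi>\<^sub>E g \<in> carrier G. A g)" using c by blast
      show "(\<lambda>g\<in>carrier G. \<pi> g x) \<in> (\<Pi>\<^sub>E g \<in> carrier G. A g)"
        using proj_in[OF _ x] by auto
      fix g assume g: "g \<in> carrier G"
      have "\<pi> g x = (if g \<in> ?N then c g else \<zero>)"
        using proj_finsum[of ?N c g] c g by (auto simp: PiE_iff)
      then show "c g = (\<lambda>g\<in>carrier G. \<pi> g x) g" using g by (auto split: if_splits)
    qed
  qed
  have "A g \<cdot> A h \<subseteq> A (g \<otimes>\<^bsub>G\<^esub> h)" if g: "g \<in> carrier G" and h: "h \<in> carrier G" for g h
  proof
    fix x assume "x \<in> A g \<cdot> A h"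
    then show "x \<in> A (g \<otimes>\<^bsub>G\<^esub> h)"
      by induction
        (use mult[OF g h] S.additive_subgroupD(3)[OF sub[OF G.m_closed[OF g h]]] in auto)
  qed
  with decomp sub show ?thesis
    by (intro graded_ring.intro graded_ring_axioms.intro assms(1,2))
qed

section \<open>Free algebras\<close>

definition monomial :: "('r, 'm) ring_scheme \<Rightarrow> 'r \<Rightarrow> 'x list \<Rightarrow> 'x list \<Rightarrow> 'r" where
  "monomial R r w = (\<lambda>u. if u = w then r else \<zero>\<^bsub>R\<^esub>)"

lemma word_monom_eq_monomial: "word_monom R w = monomial R \<one>\<^bsub>R\<^esub> w"
  by (simp add: word_monom_def monomial_def)

text \<open>The multiplication of the free algebra, which does not depend on the set of symbols.\<close>

definition convolution ::
  "('r, 'm) ring_scheme \<Rightarrow> ('x list \<Rightarrow> 'r) \<Rightarrow> ('x list \<Rightarrow> 'r) \<Rightarrow> 'x list \<Rightarrow> 'r" where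
  "convolution R a b w = (\<Oplus>\<^bsub>R\<^esub> i \<in> {..length w}. a (take i w) \<otimes>\<^bsub>R\<^esub> b (drop i w))"

lemma free_algebra_simps [simp]:
  "mult (free_algebra R X) = convolution R"
  "one (free_algebra R X) = monomial R \<one>\<^bsub>R\<^esub> []"
  "zero (free_algebra R X) = (\<lambda>w. \<zero>\<^bsub>R\<^esub>)"
  "add (free_algebra R X) = (\<lambda>a b w. a w \<oplus>\<^bsub>R\<^esub> b w)"
  by (auto simp: free_algebra_def convolution_def fun_eq_iff word_monom_eq_monomial)

lemma free_algebra_carrier_iff:
  "a \<in> carrier (free_algebra R X) \<longleftrightarrow>
    (\<forall>w. a w \<in> carrier R) \<and> finite {w. a w \<noteq> \<zero>\<^bsub>R\<^esub>} \<and> {w. a w \<noteq> \<zero>\<^bsub>R\<^esub>} \<subseteq> lists X"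
  by (simp add: free_algebra_def)

lemma free_algebra_carrierI:
  assumes "\<And>w. a w \<in> carrier R" "{w. a w \<noteq> \<zero>\<^bsub>R\<^esub>} \<subseteq> K" "finite K" "K \<subseteq> lists X"
  shows "a \<in> carrier (free_algebra R X)"
  using assms finite_subset[OF assms(2,3)] by (simp add: free_algebra_carrier_iff)

context ring
begin

lemma convolution_closed:
  "\<lbrakk>\<And>w. a w \<in> carrier R; \<And>w. b w \<in> carrier R\<rbrakk> \<Longrightarrow> convolution R a b w \<in> carrier R"
  by (auto simp: convolution_def intro!: finsum_closed)

lemma convolution_Nil:
  "\<lbrakk>\<And>w. a w \<in> carrier R; \<And>w. b w \<in> carrier R\<rbrakk> \<Longrightarrow> convolution R a b [] = a [] \<otimes> b []"
  by (simp add: convolution_def)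

text \<open>Splitting off the empty prefix gives a recursion on the word. It involves only the shifted function
\<open>\<lambda>u. a (x # u)\<close>, a kind of derivative of \<open>a\<close>, and replaces manipulations of double sums over
factorizations below.\<close>

lemma convolution_Cons:
  assumes "\<And>w. a w \<in> carrier R" "\<And>w. b w \<in> carrier R"
  shows "convolution R a b (x # w) = a [] \<otimes> b (x # w) \<oplus> convolution R (\<lambda>u. a (x # u)) b w"
  unfolding convolution_def using assms
  by (simp del: finsum_Suc add: finsum_Suc2 Pi_def a_comm)

lemma convolution_add_left:
  assumes "\<And>w. a w \<in> carrier R" "\<And>w. b w \<in> carrier R" "\<And>w. c w \<in> carrier R"
  shows "convolution R (\<lambda>w. a w \<oplus> b w) c w = convolution R a c w \<oplus> convolution R b c w"
  unfolding convolution_def using assms by (simp add: l_distr finsum_addf)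

lemma convolution_add_right:
  assumes "\<And>w. a w \<in> carrier R" "\<And>w. b w \<in> carrier R" "\<And>w. c w \<in> carrier R"
  shows "convolution R a (\<lambda>w. b w \<oplus> c w) w = convolution R a b w \<oplus> convolution R a c w"
  unfolding convolution_def using assms by (simp add: r_distr finsum_addf)

lemma convolution_scale:
  assumes "r \<in> carrier R" "\<And>w. a w \<in> carrier R" "\<And>w. b w \<in> carrier R"
  shows "convolution R (\<lambda>w. r \<otimes> a w) b w = r \<otimes> convolution R a b w"
  unfolding convolution_def using assms by (simp add: m_assoc finsum_rdistr)

text \<open>Induction on the word, generalized over the left factor: by the recursion, the shift of
\<open>a b\<close> by \<open>x\<close> is \<open>a []\<close> times the shift of \<open>b\<close>, plus the shift of \<open>a\<close> times \<open>b\<close>. The first part is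
handled by distributivity, the second by the induction hypothesis.\<close>

lemma convolution_assoc:
  assumes "\<And>w. a w \<in> carrier R" "\<And>w. b w \<in> carrier R" "\<And>w. c w \<in> carrier R"
  shows "convolution R (convolution R a b) c w = convolution R a (convolution R b c) w"
  using assms
proof (induction w arbitrary: a)
  case Nil
  then show ?case by (simp add: convolution_Nil convolution_closed m_assoc)
next
  case (Cons x w)
  let ?da = "\<lambda>u. a (x # u)" and ?db = "\<lambda>u. b (x # u)"
  have "(\<lambda>u. convolution R a b (x # u)) = (\<lambda>u. a [] \<otimes> ?db u \<oplus> convolution R ?da b u)"
    using Cons.prems by (simp add: convolution_Cons)
  then have "convolution R (convolution R a b) c (x # w) =
      a [] \<otimes> b [] \<otimes> c (x # w) \<oplus> (a [] \<otimes> convolution R ?db c w \<oplus> convolution R (convolution R ?da b) c w)"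
    using Cons.prems
    by (simp add: convolution_Cons convolution_Nil convolution_closed convolution_add_left convolution_scale)
  also have "\<dots> = a [] \<otimes> convolution R b c (x # w) \<oplus> convolution R ?da (convolution R b c) w"
    using Cons.prems Cons.IH[of ?da]
    by (simp add: convolution_Cons convolution_closed r_distr m_assoc a_assoc)
  also have "\<dots> = convolution R a (convolution R b c) (x # w)"
    using Cons.prems by (simp add: convolution_Cons convolution_closed)
  finally show ?case .
qed

lemma convolution_zero_left:
  "(\<And>w. b w \<in> carrier R) \<Longrightarrow> convolution R (\<lambda>w. \<zero>) b w = \<zero>"
  by (simp add: convolution_def)

lemma convolution_monomial_left:
  assumes "r \<in> carrier R" "\<And>w. b w \<in> carrier R"
  shows "convolution R (monomial R r u) b w =
    (if take (length u) w = u then r \<otimes> b (drop (length u) w) else \<zero>)"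
  using assms
proof (induction w arbitrary: u)
  case Nil
  then show ?case by (auto simp: convolution_Nil monomial_def)
next
  case (Cons x w)
  have "(\<lambda>v. monomial R r u (x # v)) =
      (case u of [] \<Rightarrow> (\<lambda>v. \<zero>) | y # u' \<Rightarrow> if y = x then monomial R r u' else (\<lambda>v. \<zero>))"
    by (auto simp: monomial_def fun_eq_iff split: list.split)
  moreover have "monomial R r u v \<in> carrier R" for v
    using Cons.prems by (simp add: monomial_def)
  ultimately show ?case
    using Cons by (cases u) (auto simp: convolution_Cons convolution_zero_left monomial_def)
qed

lemma monomial_mult:
  assumes "r \<in> carrier R" "s \<in> carrier R"
  shows "convolution R (monomial R r u) (monomial R s v) = monomial R (r \<otimes> s) (u @ v)"
proof
  fix w
  have "take (length u) w = u \<and> drop (length u) w = v \<longleftrightarrow> w = u @ v"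
    by (metis append_eq_conv_conj)
  then show "convolution R (monomial R r u) (monomial R s v) w = monomial R (r \<otimes> s) (u @ v) w"
    using assms convolution_monomial_left[of r "monomial R s v" u w]
    by (auto simp: monomial_def)
qed

lemma monomial_closed:
  "r \<in> carrier R \<Longrightarrow> w \<in> lists X \<Longrightarrow> monomial R r w \<in> carrier (free_algebra R X)"
proof -
  assume *: "r \<in> carrier R" "w \<in> lists X"
  have "{u. monomial R r w u \<noteq> \<zero>} \<subseteq> {w}" by (auto simp: monomial_def)
  with * show ?thesis
    by (intro free_algebra_carrierI[of _ R "{w}"]) (simp_all add: monomial_def)
qed

lemma convolution_support:
  assumes "\<And>w. a w \<in> carrier R" "\<And>w. b w \<in> carrier R" "convolution R a b w \<noteq> \<zero>"
  obtains u v where "w = u @ v" "a u \<noteq> \<zero>" "b v \<noteq> \<zero>"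
proof -
  have "\<exists>i. a (take i w) \<noteq> \<zero> \<and> b (drop i w) \<noteq> \<zero>"
  proof (rule ccontr)
    assume "\<not> ?thesis"
    then have "a (take i w) \<otimes> b (drop i w) = \<zero>" for i using assms by (metis l_null r_null)
    then show False using assms by (simp add: convolution_def)
  qed
  then show ?thesis using that by (metis append_take_drop_id)
qed

lemma free_algebra_mult_closed:
  assumes "a \<in> carrier (free_algebra R X)" "b \<in> carrier (free_algebra R X)"
  shows "convolution R a b \<in> carrier (free_algebra R X)"
proof -
  let ?A = "{w. a w \<noteq> \<zero>}" and ?B = "{w. b w \<noteq> \<zero>}"
  have car: "a w \<in> carrier R" "b w \<in> carrier R" for w
    using assms by (simp_all add: free_algebra_carrier_iff)
  have sub: "{w. convolution R a b w \<noteq> \<zero>} \<subseteq> (\<lambda>(u, v). u @ v) ` (?A \<times> ?B)"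
  proof
    fix w assume "w \<in> {w. convolution R a b w \<noteq> \<zero>}"
    then obtain u v where "w = u @ v" "a u \<noteq> \<zero>" "b v \<noteq> \<zero>"
      using convolution_support[of a b w] car by blast
    then show "w \<in> (\<lambda>(u, v). u @ v) ` (?A \<times> ?B)" by force
  qed
  moreover have "finite ((\<lambda>(u, v). u @ v) ` (?A \<times> ?B))"
    using assms by (simp add: free_algebra_carrier_iff)
  moreover have "(\<lambda>(u, v). u @ v) ` (?A \<times> ?B) \<subseteq> lists X"
  proof (rule image_subsetI)
    fix p assume p: "p \<in> ?A \<times> ?B"
    have A: "?A \<subseteq> lists X" and B: "?B \<subseteq> lists X"
      using assms by (simp_all add: free_algebra_carrier_iff)
    have "fst p \<in> ?A" "snd p \<in> ?B" using p by (simp_all add: mem_Times_iff)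
    then have "fst p \<in> lists X \<and> snd p \<in> lists X" using subsetD[OF A] subsetD[OF B] by iprover
    then have "fst p @ snd p \<in> lists X" unfolding append_in_lists_conv .
    then show "(\<lambda>(u, v). u @ v) p \<in> lists X" by (simp only: case_prod_beta)
  qed
  ultimately show ?thesis
    using car by (intro free_algebra_carrierI[OF _ sub] convolution_closed) simp_all
qed

lemma free_algebra_add_closed:
  assumes "a \<in> carrier (free_algebra R X)" "b \<in> carrier (free_algebra R X)"
  shows "(\<lambda>w. a w \<oplus> b w) \<in> carrier (free_algebra R X)"
proof -
  have sub: "{w. a w \<oplus> b w \<noteq> \<zero>} \<subseteq> {w. a w \<noteq> \<zero>} \<union> {w. b w \<noteq> \<zero>}" by auto
  moreover have "finite ({w. a w \<noteq> \<zero>} \<union> {w. b w \<noteq> \<zero>})" "{w. a w \<noteq> \<zero>} \<union> {w. b w \<noteq> \<zero>} \<subseteq> lists X"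
    using assms by (simp_all add: free_algebra_carrier_iff)
  ultimately show ?thesis
    using assms by (intro free_algebra_carrierI[OF _ sub]) (simp_all add: free_algebra_carrier_iff)
qed

lemma free_algebra_map_closed:
  assumes a: "a \<in> carrier (free_algebra R X)"
    and f: "\<And>w r. r \<in> carrier R \<Longrightarrow> f w r \<in> carrier R" "\<And>w. f w \<zero> = \<zero>"
  shows "(\<lambda>w. f w (a w)) \<in> carrier (free_algebra R X)"
proof -
  have "{w. f w (a w) \<noteq> \<zero>} \<subseteq> {w. a w \<noteq> \<zero>}" using f(2) by auto
  with a f show ?thesis
    by (intro free_algebra_carrierI[of _ R "{w. a w \<noteq> \<zero>}"]) (simp_all add: free_algebra_carrier_iff)
qed

lemma free_algebra_restrict_closed:
  "a \<in> carrier (free_algebra R X) \<Longrightarrow> (\<lambda>w. if P w then a w else \<zero>) \<in> carrier (free_algebra R X)"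
  by (rule free_algebra_map_closed[where f = "\<lambda>w r. if P w then r else \<zero>"]) simp_all

lemma free_algebra_minus_closed:
  "a \<in> carrier (free_algebra R X) \<Longrightarrow> (\<lambda>w. \<ominus> a w) \<in> carrier (free_algebra R X)"
  by (rule free_algebra_map_closed[where f = "\<lambda>w r. \<ominus> r"]) simp_all

lemma free_algebra_ring:
  fixes X :: "'x set"
  shows "ring (free_algebra R X)" (is "ring ?F")
proof (rule ringI)
  have car: "a w \<in> carrier R" if "a \<in> carrier ?F" for a w
    using that by (simp add: free_algebra_carrier_iff)
  show "abelian_group ?F"
  proof (rule abelian_groupI)
    fix a assume a: "a \<in> carrier ?F"
    show "\<exists>b\<in>carrier ?F. b \<oplus>\<^bsub>?F\<^esub> a = \<zero>\<^bsub>?F\<^esub>"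
      using a by (intro bexI[of _ "\<lambda>w. \<ominus> a w"] free_algebra_minus_closed) (auto simp: car l_neg)
  qed (simp_all add: free_algebra_add_closed car a_ac fun_eq_iff,
      simp add: free_algebra_carrier_iff)
  show "monoid ?F"
  proof (rule monoidI)
    fix a assume a: "a \<in> carrier ?F"
    show "\<one>\<^bsub>?F\<^esub> \<otimes>\<^bsub>?F\<^esub> a = a"
      using a by (auto simp: convolution_monomial_left car)
    show "a \<otimes>\<^bsub>?F\<^esub> \<one>\<^bsub>?F\<^esub> = a"
    proof
      fix w
      have mon: "monomial R \<one> [] u \<in> carrier R" for u :: "'x list" by (simp add: monomial_def)
      show "(a \<otimes>\<^bsub>?F\<^esub> \<one>\<^bsub>?F\<^esub>) w = a w"
        using car[OF a]
      proof (induction w arbitrary: a)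
        case (Cons x w)
        have "convolution R a (monomial R \<one> []) (x # w) =
            a [] \<otimes> monomial R \<one> [] (x # w) \<oplus> convolution R (\<lambda>u. a (x # u)) (monomial R \<one> []) w"
          using Cons.prems mon by (rule convolution_Cons)
        also have "convolution R (\<lambda>u. a (x # u)) (monomial R \<one> []) w = a (x # w)"
          using Cons.IH[of "\<lambda>u. a (x # u)"] Cons.prems by simp
        finally show ?case using Cons.prems by (simp add: monomial_def)
      qed (simp add: convolution_Nil mon, simp add: monomial_def)
    qed
  qed (simp_all add: free_algebra_mult_closed monomial_closed convolution_assoc car fun_eq_iff)
next
  fix a b c assume abc: "a \<in> carrier ?F" "b \<in> carrier ?F" "c \<in> carrier ?F"
  then have car: "a w \<in> carrier R" "b w \<in> carrier R" "c w \<in> carrier R" for w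
    by (simp_all add: free_algebra_carrier_iff)
  show "(a \<oplus>\<^bsub>?F\<^esub> b) \<otimes>\<^bsub>?F\<^esub> c = a \<otimes>\<^bsub>?F\<^esub> c \<oplus>\<^bsub>?F\<^esub> b \<otimes>\<^bsub>?F\<^esub> c"
    unfolding free_algebra_simps by (intro ext convolution_add_left car)
  show "c \<otimes>\<^bsub>?F\<^esub> (a \<oplus>\<^bsub>?F\<^esub> b) = c \<otimes>\<^bsub>?F\<^esub> a \<oplus>\<^bsub>?F\<^esub> c \<otimes>\<^bsub>?F\<^esub> b"
    unfolding free_algebra_simps by (intro ext convolution_add_right car)
qed

lemma free_algebra_a_inv:
  assumes "a \<in> carrier (free_algebra R X)"
  shows "\<ominus>\<^bsub>free_algebra R X\<^esub> a = (\<lambda>w. \<ominus> a w)"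
proof -
  interpret F: ring "free_algebra R X" by (rule free_algebra_ring)
  show ?thesis
    by (rule F.minus_equality)
      (use assms free_algebra_minus_closed in \<open>auto simp: l_neg free_algebra_carrier_iff\<close>)
qed

text \<open>An element is the finite sum of its terms; additive statements thus need checking only on the monomials
that actually occur in it.\<close>

lemma free_algebra_induct [consumes 1, case_names zero monomial add]:
  assumes a: "a \<in> carrier (free_algebra R X)"
    and zero: "P (\<lambda>w. \<zero>)"
    and monomial: "\<And>w. a w \<noteq> \<zero> \<Longrightarrow> P (monomial R (a w) w)"
    and add: "\<And>b c. \<lbrakk>b \<in> carrier (free_algebra R X); c \<in> carrier (free_algebra R X); P b; P c\<rbrakk>
      \<Longrightarrow> P (\<lambda>w. b w \<oplus> c w)"
  shows "P a"
proof -
  have car: "a w \<in> carrier R" for w using a by (simp add: free_algebra_carrier_iff)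
  have "P (\<lambda>w. if w \<in> K then a w else \<zero>)" if "finite K" "K \<subseteq> {w. a w \<noteq> \<zero>}" for K
    using that
  proof (induction K)
    case (insert k K)
    let ?b = "\<lambda>w. if w \<in> K then a w else \<zero>"
    have "k \<in> lists X" using insert.prems a by (auto simp: free_algebra_carrier_iff)
    then have "P (\<lambda>w. monomial R (a k) k w \<oplus> ?b w)"
      using insert free_algebra_restrict_closed[OF a, of "\<lambda>w. w \<in> K"]
      by (intro add monomial monomial_closed car) auto
    moreover have "(\<lambda>w. monomial R (a k) k w \<oplus> ?b w) = (\<lambda>w. if w \<in> insert k K then a w else \<zero>)"
      using insert.hyps by (auto simp: monomial_def car fun_eq_iff)
    ultimately show ?case by simp
  qed (use zero in simp)
  from this[of "{w. a w \<noteq> \<zero>}"] have "P (\<lambda>w. if a w \<noteq> \<zero> then a w else \<zero>)"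
    using a by (simp add: free_algebra_carrier_iff)
  moreover have "(\<lambda>w. if a w \<noteq> \<zero> then a w else \<zero>) = a" by auto
  ultimately show ?thesis by simp
qed

end

section \<open>Range projections of words in a graph\<close>

fun gen_adjoint :: "('v, 'e) lpa_gen \<Rightarrow> ('v, 'e) lpa_gen" where
  "gen_adjoint (Vertex v) = Vertex v"
| "gen_adjoint (Edge f) = Ghost f"
| "gen_adjoint (Ghost f) = Edge f"

definition word_adjoint :: "('v, 'e) lpa_gen list \<Rightarrow> ('v, 'e) lpa_gen list" where
  "word_adjoint w = rev (map gen_adjoint w)"

lemma gen_adjoint_in_iff [simp]: "gen_adjoint x \<in> lpa_gens E \<longleftrightarrow> x \<in> lpa_gens E"
  by (cases x) (auto simp: lpa_gens_def)

lemma word_adjoint_Cons: "word_adjoint (x # w) = word_adjoint w @ [gen_adjoint x]"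
  by (simp add: word_adjoint_def)

lemma word_adjoint_in_lists [simp]: "w \<in> lists (lpa_gens E) \<Longrightarrow> word_adjoint w \<in> lists (lpa_gens E)"
  by (auto simp: word_adjoint_def)

lemma word_adjoint_Nil_iff [simp]: "word_adjoint w = [] \<longleftrightarrow> w = []"
  by (simp add: word_adjoint_def)

lemma word_adjoint_adjoint [simp]: "word_adjoint (word_adjoint w) = w"
proof -
  have "gen_adjoint (gen_adjoint x) = x" for x :: "('a, 'b) lpa_gen" by (cases x) auto
  then show ?thesis by (simp add: word_adjoint_def rev_map o_def)
qed

text \<open>Elements of a unital ring that satisfy the relations of the Cohn path algebra of \<open>E\<close>, which say that
vertices are orthogonal idempotents and edges are partial isometries with orthogonal range projections. In the
application the unital ring is the quotient of the unital free algebra.\<close>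

locale cohn_family = ring Q + wf_digraph E
  for Q (structure) and E :: "('v, 'e) pre_digraph" and \<gamma> :: "('v, 'e) lpa_gen \<Rightarrow> 'q" +
  assumes gen_closed: "x \<in> lpa_gens E \<Longrightarrow> \<gamma> x \<in> carrier Q"
    and vertex_vertex: "\<lbrakk>u \<in> verts E; v \<in> verts E\<rbrakk>
      \<Longrightarrow> \<gamma> (Vertex u) \<otimes> \<gamma> (Vertex v) = (if u = v then \<gamma> (Vertex v) else \<zero>)"
    and tail_edge: "f \<in> arcs E \<Longrightarrow> \<gamma> (Vertex (tail E f)) \<otimes> \<gamma> (Edge f) = \<gamma> (Edge f)"
    and edge_head: "f \<in> arcs E \<Longrightarrow> \<gamma> (Edge f) \<otimes> \<gamma> (Vertex (head E f)) = \<gamma> (Edge f)"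
    and head_ghost: "f \<in> arcs E \<Longrightarrow> \<gamma> (Vertex (head E f)) \<otimes> \<gamma> (Ghost f) = \<gamma> (Ghost f)"
    and ghost_tail: "f \<in> arcs E \<Longrightarrow> \<gamma> (Ghost f) \<otimes> \<gamma> (Vertex (tail E f)) = \<gamma> (Ghost f)"
    and ghost_edge: "\<lbrakk>f \<in> arcs E; f' \<in> arcs E\<rbrakk>
      \<Longrightarrow> \<gamma> (Ghost f) \<otimes> \<gamma> (Edge f') = (if f = f' then \<gamma> (Vertex (head E f)) else \<zero>)"
begin

lemma gens_closed [simp]:
  "v \<in> verts E \<Longrightarrow> \<gamma> (Vertex v) \<in> carrier Q"
  "f \<in> arcs E \<Longrightarrow> \<gamma> (Edge f) \<in> carrier Q"
  "f \<in> arcs E \<Longrightarrow> \<gamma> (Ghost f) \<in> carrier Q"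
  by (auto intro!: gen_closed simp: lpa_gens_def)

lemma vertex_edge:
  "\<lbrakk>v \<in> verts E; f \<in> arcs E\<rbrakk>
    \<Longrightarrow> \<gamma> (Vertex v) \<otimes> \<gamma> (Edge f) = (if v = tail E f then \<gamma> (Edge f) else \<zero>)"
  using tail_edge m_assoc[of "\<gamma> (Vertex v)" "\<gamma> (Vertex (tail E f))" "\<gamma> (Edge f)"]
  by (auto simp: vertex_vertex)

lemma ghost_vertex:
  "\<lbrakk>v \<in> verts E; f \<in> arcs E\<rbrakk>
    \<Longrightarrow> \<gamma> (Ghost f) \<otimes> \<gamma> (Vertex v) = (if v = tail E f then \<gamma> (Ghost f) else \<zero>)"
  using ghost_tail m_assoc[of "\<gamma> (Ghost f)" "\<gamma> (Vertex (tail E f))" "\<gamma> (Vertex v)"]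
  by (auto simp: vertex_vertex)

text \<open>The relations in the form that they take inside a product bracketed to the right.\<close>

lemma gens_absorb:
  assumes "z \<in> carrier Q"
  shows "\<lbrakk>v \<in> verts E; f \<in> arcs E\<rbrakk>
      \<Longrightarrow> \<gamma> (Vertex v) \<otimes> (\<gamma> (Edge f) \<otimes> z) = (if v = tail E f then \<gamma> (Edge f) \<otimes> z else \<zero>)"
    and "\<lbrakk>v \<in> verts E; f \<in> arcs E\<rbrakk>
      \<Longrightarrow> \<gamma> (Ghost f) \<otimes> (\<gamma> (Vertex v) \<otimes> z) = (if v = tail E f then \<gamma> (Ghost f) \<otimes> z else \<zero>)"
    and "f \<in> arcs E \<Longrightarrow> \<gamma> (Edge f) \<otimes> (\<gamma> (Vertex (head E f)) \<otimes> z) = \<gamma> (Edge f) \<otimes> z"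
    and "f \<in> arcs E \<Longrightarrow> \<gamma> (Vertex (head E f)) \<otimes> (\<gamma> (Ghost f) \<otimes> z) = \<gamma> (Ghost f) \<otimes> z"
    and "\<lbrakk>f \<in> arcs E; f' \<in> arcs E\<rbrakk> \<Longrightarrow> \<gamma> (Ghost f) \<otimes> (\<gamma> (Edge f') \<otimes> z) =
      (if f = f' then \<gamma> (Vertex (head E f)) \<otimes> z else \<zero>)"
  using assms
  by (simp_all add: m_assoc[symmetric] vertex_edge ghost_vertex edge_head head_ghost ghost_edge)

text \<open>The elements \<open>\<alpha> \<alpha>\<^sup>*\<close> for paths \<open>\<alpha>\<close>, built by prolonging \<open>\<alpha>\<close> at its start, together with zero.\<close>

inductive_set projections :: "'q set" where
  zero: "\<zero> \<in> projections"
| vertex: "v \<in> verts E \<Longrightarrow> \<gamma> (Vertex v) \<in> projections"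
| conj: "f \<in> arcs E \<Longrightarrow> e \<in> projections \<Longrightarrow> \<gamma> (Edge f) \<otimes> (e \<otimes> \<gamma> (Ghost f)) \<in> projections"

lemma projections_closed [simp]: "e \<in> projections \<Longrightarrow> e \<in> carrier Q"
  by (induction rule: projections.induct) auto

text \<open>A projection is zero, a vertex, or begins with an edge \<open>f\<close> and ends with \<open>f\<^sup>*\<close>; each of these is fixed or
annihilated by a vertex, from either side.\<close>

lemma vertex_projection:
  assumes "v \<in> verts E" "e \<in> projections"
  shows "\<gamma> (Vertex v) \<otimes> e \<in> {e, \<zero>}" and "e \<otimes> \<gamma> (Vertex v) = \<gamma> (Vertex v) \<otimes> e"
  using assms(2,1)
  by (induction rule: projections.induct)
    (auto simp: vertex_vertex m_assoc gens_absorb ghost_vertex)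

text \<open>Projections that begin with different edges annihilate each other. If both begin with \<open>f\<close>, then
\<open>(f e f\<^sup>*) (f e' f\<^sup>*) = f e e' f\<^sup>*\<close>, because the inner \<open>f\<^sup>* f\<close> is the range of \<open>f\<close>, which commutes with
\<open>e\<close> and is absorbed by \<open>f\<close>; so the claim reduces to \<open>e\<close> and \<open>e'\<close>.\<close>

lemma projections_commute:
  "e \<in> projections \<Longrightarrow> e' \<in> projections \<Longrightarrow> e \<otimes> e' = e' \<otimes> e"
proof (induction arbitrary: e' rule: projections.induct)
  case (vertex v)
  then show ?case by (simp add: vertex_projection(2))
next
  case (conj f e)
  from conj.prems show ?case
  proof (cases rule: projections.cases)
    case (vertex v)
    have "\<gamma> (Edge f) \<otimes> (e \<otimes> \<gamma> (Ghost f)) \<in> projections"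
      using conj.hyps by (rule projections.conj)
    then show ?thesis using vertex by (simp add: vertex_projection(2))
  next
    case (conj f' e'')
    note e'' = this
    show ?thesis
    proof (cases "f = f'")
      case True
      let ?v = "\<gamma> (Vertex (head E f))"
      have swap: "\<gamma> (Edge f) \<otimes> (e \<otimes> (?v \<otimes> (e' \<otimes> z))) = \<gamma> (Edge f) \<otimes> (e \<otimes> (e' \<otimes> z))"
        if "e \<in> projections" "e' \<in> projections" "z \<in> carrier Q" for e e' z
      proof -
        have "e \<otimes> (?v \<otimes> (e' \<otimes> z)) = ?v \<otimes> (e \<otimes> (e' \<otimes> z))"
          using that vertex_projection(2)[of "head E f" e] conj.hyps \<open>f \<in> arcs E\<close>
          by (simp add: m_assoc[symmetric])
        then show ?thesis using that \<open>f \<in> arcs E\<close> by (simp add: gens_absorb)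
      qed
      have "e \<otimes> (e'' \<otimes> \<gamma> (Ghost f)) = e'' \<otimes> (e \<otimes> \<gamma> (Ghost f))"
        using conj.IH[of e''] e'' conj.hyps \<open>e \<in> projections\<close> \<open>f \<in> arcs E\<close>
        by (simp add: m_assoc[symmetric])
      then show ?thesis
        using True e'' \<open>e \<in> projections\<close> \<open>f \<in> arcs E\<close> by (simp add: m_assoc gens_absorb swap[unfolded True])
    next
      case False
      then show ?thesis
        using e'' \<open>e \<in> projections\<close> \<open>f \<in> arcs E\<close> by (simp add: m_assoc gens_absorb)
    qed
  qed (use conj in simp)
qed simp

text \<open>For an edge this is the definition. For a ghost edge, \<open>f\<^sup>* e f\<close> removes the first edge of the path of
\<open>e\<close> if that edge is \<open>f\<close>, is the range of \<open>f\<close> if \<open>e\<close> is the source of \<open>f\<close>, and vanishes otherwise.\<close>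

lemma conj_projection:
  assumes "x \<in> lpa_gens E" "e \<in> projections"
  shows "\<gamma> x \<otimes> (e \<otimes> \<gamma> (gen_adjoint x)) \<in> projections"
proof (cases x)
  case (Vertex v)
  then have v: "v \<in> verts E" using assms(1) by (auto simp: lpa_gens_def)
  then have "\<gamma> (Vertex v) \<otimes> (e \<otimes> \<gamma> (Vertex v)) = \<gamma> (Vertex v) \<otimes> e"
    using vertex_projection(2)[OF v assms(2)] assms(2)
    by (simp add: m_assoc[symmetric] vertex_vertex)
  then show ?thesis
    using Vertex vertex_projection(1)[OF v assms(2)] assms(2) projections.zero by auto
next
  case (Edge f)
  then show ?thesis using assms by (auto simp: lpa_gens_def intro: projections.conj)
next
  case (Ghost f)
  then have f: "f \<in> arcs E" using assms(1) by (auto simp: lpa_gens_def)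
  have "\<gamma> (Ghost f) \<otimes> (e \<otimes> \<gamma> (Edge f)) \<in> projections"
    using assms(2)
  proof (cases rule: projections.cases)
    case (conj f' e')
    have v: "head E f \<in> verts E" using f by simp
    have "\<gamma> (Vertex (head E f)) \<otimes> (e' \<otimes> \<gamma> (Vertex (head E f))) \<in> {e', \<zero>}"
      using vertex_projection[OF v conj(3)] conj v
      by (auto simp: vertex_vertex m_assoc[symmetric])
    then show ?thesis
      using conj f projections.zero by (auto simp: m_assoc gens_absorb ghost_edge)
  qed (use f projections.zero projections.vertex in \<open>auto simp: vertex_edge ghost_edge\<close>)
  then show ?thesis using Ghost by simp
qed

text \<open>The only product \<open>x\<^sup>* x\<close> that is not a vertex is \<open>f f\<^sup>*\<close>, which is the range of \<open>f\<close> conjugated by \<open>f\<close>.\<close>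

lemma gen_adjoint_gen:
  assumes "x \<in> lpa_gens E"
  shows "\<gamma> (gen_adjoint x) \<otimes> \<gamma> x \<in> projections"
    and "\<gamma> x \<otimes> (\<gamma> (gen_adjoint x) \<otimes> \<gamma> x) = \<gamma> x"
proof -
  have "\<gamma> (Edge f) \<otimes> \<gamma> (Ghost f) \<in> projections" if "f \<in> arcs E" for f
    using projections.conj[OF that projections.vertex[of "head E f"]] that
    by (simp add: head_ghost)
  then show "\<gamma> (gen_adjoint x) \<otimes> \<gamma> x \<in> projections"
    and "\<gamma> x \<otimes> (\<gamma> (gen_adjoint x) \<otimes> \<gamma> x) = \<gamma> x"
    using assms projections.vertex
    by (cases x; auto simp: lpa_gens_def vertex_vertex ghost_edge edge_head gens_absorb head_ghost)+
qed

definition word_prod :: "('v, 'e) lpa_gen list \<Rightarrow> 'q" where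
  "word_prod w = foldr (\<lambda>x y. \<gamma> x \<otimes> y) w \<one>"

lemma word_prod_simps [simp]:
  "word_prod [] = \<one>"
  "word_prod (x # w) = \<gamma> x \<otimes> word_prod w"
  by (simp_all add: word_prod_def)

lemma word_prod_closed [simp]: "w \<in> lists (lpa_gens E) \<Longrightarrow> word_prod w \<in> carrier Q"
  by (induction w) (auto simp: gen_closed)

lemma word_prod_append:
  "u \<in> lists (lpa_gens E) \<Longrightarrow> v \<in> lists (lpa_gens E)
    \<Longrightarrow> word_prod (u @ v) = word_prod u \<otimes> word_prod v"
  by (induction u) (auto simp: gen_closed m_assoc)

lemma word_prod_adjoint_Cons:
  "x \<in> lpa_gens E \<Longrightarrow> w \<in> lists (lpa_gens E)
    \<Longrightarrow> word_prod (word_adjoint (x # w)) = word_prod (word_adjoint w) \<otimes> \<gamma> (gen_adjoint x)"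
  by (simp add: word_adjoint_Cons word_prod_append gen_closed del: in_lists_conv_set)

text \<open>Prefixing a letter \<open>x\<close> turns \<open>w w\<^sup>*\<close> into \<open>x (w w\<^sup>*) x\<^sup>*\<close>. The empty word is excluded because it
gives the unit of the ambient ring, which need not be a projection of the family.\<close>

lemma word_range_projection:
  "w \<in> lists (lpa_gens E) \<Longrightarrow> w \<noteq> []
    \<Longrightarrow> word_prod w \<otimes> word_prod (word_adjoint w) \<in> projections"
proof (induction w)
  case (Cons x w)
  show ?case
  proof (cases "w = []")
    case True
    have "gen_adjoint (gen_adjoint x) = x" by (cases x) auto
    then show ?thesis
      using gen_adjoint_gen(1)[of "gen_adjoint x"] Cons.prems True
      by (simp add: word_adjoint_def gen_closed)
  next
    case False
    then have "\<gamma> x \<otimes> (word_prod w \<otimes> word_prod (word_adjoint w) \<otimes> \<gamma> (gen_adjoint x)) \<in> projections"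
      using Cons by (intro conj_projection) auto
    then show ?thesis using Cons.prems by (simp add: word_prod_adjoint_Cons m_assoc gen_closed)
  qed
qed simp

text \<open>In \<open>x w w\<^sup>* x\<^sup>* x w\<close> the projections \<open>w w\<^sup>*\<close> and \<open>x\<^sup>* x\<close> commute, which leaves
\<open>(x x\<^sup>* x) (w w\<^sup>* w)\<close>.\<close>

lemma word_partial_isometry:
  "w \<in> lists (lpa_gens E) \<Longrightarrow> word_prod w \<otimes> word_prod (word_adjoint w) \<otimes> word_prod w = word_prod w"
proof (induction w)
  case (Cons x w)
  let ?w = "word_prod w" and ?w' = "word_prod (word_adjoint w)"
  let ?x = "\<gamma> x" and ?x' = "\<gamma> (gen_adjoint x)"
  have car: "?w \<in> carrier Q" "?w' \<in> carrier Q" "?x \<in> carrier Q" "?x' \<in> carrier Q"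
    using Cons.prems by (auto intro: gen_closed)
  have "(?w \<otimes> ?w') \<otimes> (?x' \<otimes> ?x) = (?x' \<otimes> ?x) \<otimes> (?w \<otimes> ?w')"
  proof (cases "w = []")
    case False
    then show ?thesis
      using Cons.prems by (intro projections_commute word_range_projection gen_adjoint_gen) auto
  qed (use car in \<open>simp add: word_adjoint_def\<close>)
  then have "?x \<otimes> (((?w \<otimes> ?w') \<otimes> (?x' \<otimes> ?x)) \<otimes> ?w) = ?x \<otimes> (?x' \<otimes> ?x) \<otimes> (?w \<otimes> ?w' \<otimes> ?w)"
    using car by (simp add: m_assoc)
  also have "\<dots> = ?x \<otimes> ?w" using Cons gen_adjoint_gen(2)[of x] by simp
  finally show ?case
    using Cons.prems car by (simp add: word_prod_adjoint_Cons m_assoc)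
qed (simp add: word_adjoint_def)

end

section \<open>Homogeneous parts and the ideal of relators\<close>

lemma (in abelian_group) additive_subgroup_finsum:
  assumes "additive_subgroup H G" "finite K" "\<And>k. k \<in> K \<Longrightarrow> f k \<in> H"
  shows "(\<Oplus>k\<in>K. f k) \<in> H"
  using assms(2,3)
proof (induction K)
  case (insert k K)
  then have "f k \<in> carrier G" "f \<in> K \<rightarrow> carrier G"
    using additive_subgroupD(1)[OF assms(1)] by auto
  then show ?case using insert additive_subgroupD(3)[OF assms(1)] by (simp add: finsum_insert)
qed (use additive_subgroupD(2)[OF assms(1)] in simp)

locale leavitt_grading = R: ring R + G: group G + E: wf_digraph E
  for R :: "('r, 'm) ring_scheme" and G :: "('g, 'n) monoid_scheme"
    and E :: "('v, 'e) pre_digraph" and d :: "'e \<Rightarrow> 'g" +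
  assumes arc_degree: "d \<in> arcs E \<rightarrow> carrier G"
begin

abbreviation "X \<equiv> lpa_gens E"
abbreviation "F \<equiv> lpa_free R E"
abbreviation "I \<equiv> lpa_ideal R E"
abbreviation "Q \<equiv> F Quot I"
abbreviation "L \<equiv> leavitt_path_algebra R E"
abbreviation "deg \<equiv> word_degree G d"
abbreviation "N \<equiv> nonunital_part R X"
abbreviation "cls a \<equiv> I +>\<^bsub>F\<^esub> a"
abbreviation "component \<equiv> standard_gradation R E G d"

sublocale F: ring F by (rule R.free_algebra_ring)

lemma free_carrierD:
  assumes "a \<in> carrier F"
  shows "a w \<in> carrier R" "finite {w. a w \<noteq> \<zero>\<^bsub>R\<^esub>}" "a w \<noteq> \<zero>\<^bsub>R\<^esub> \<Longrightarrow> w \<in> lists X"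
  using assms by (auto simp: free_algebra_carrier_iff)

lemma gen_degree_closed: "x \<in> X \<Longrightarrow> gen_degree G d x \<in> carrier G"
  using arc_degree by (auto simp: lpa_gens_def Pi_iff)

lemma deg_Nil [simp]: "deg [] = \<one>\<^bsub>G\<^esub>"
  and deg_Cons [simp]: "deg (x # w) = gen_degree G d x \<otimes>\<^bsub>G\<^esub> deg w"
  by (simp_all add: word_degree_def)

lemma deg_closed: "w \<in> lists X \<Longrightarrow> deg w \<in> carrier G"
  by (induction w) (auto simp: gen_degree_closed)

lemma deg_append:
  "u \<in> lists X \<Longrightarrow> v \<in> lists X \<Longrightarrow> deg (u @ v) = deg u \<otimes>\<^bsub>G\<^esub> deg v"
  by (induction u) (auto simp: gen_degree_closed deg_closed G.m_assoc)

definition homogeneous :: "'g \<Rightarrow> (('v, 'e) lpa_gen list \<Rightarrow> 'r) set" where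
  "homogeneous g = {a \<in> carrier F. \<forall>w. a w \<noteq> \<zero>\<^bsub>R\<^esub> \<longrightarrow> deg w = g}"

definition hom_part :: "'g \<Rightarrow> (('v, 'e) lpa_gen list \<Rightarrow> 'r) \<Rightarrow> ('v, 'e) lpa_gen list \<Rightarrow> 'r" where
  "hom_part g a = (\<lambda>w. if deg w = g then a w else \<zero>\<^bsub>R\<^esub>)"

lemma hom_part_homogeneous: "a \<in> carrier F \<Longrightarrow> hom_part g a \<in> homogeneous g"
  by (auto simp: homogeneous_def hom_part_def R.free_algebra_restrict_closed)

lemma hom_part_closed [simp]: "a \<in> carrier F \<Longrightarrow> hom_part g a \<in> carrier F"
  by (simp add: hom_part_def R.free_algebra_restrict_closed)

lemma hom_part_of_homogeneous:
  assumes "a \<in> homogeneous h"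
  shows "hom_part g a = (if g = h then a else \<zero>\<^bsub>F\<^esub>)"
proof
  fix w
  have "a w = \<zero>\<^bsub>R\<^esub>" if "deg w \<noteq> h" using assms that unfolding homogeneous_def by blast
  then show "hom_part g a w = (if g = h then a else \<zero>\<^bsub>F\<^esub>) w" by (auto simp: hom_part_def)
qed

lemma hom_part_zero: "hom_part g \<zero>\<^bsub>F\<^esub> = \<zero>\<^bsub>F\<^esub>"
  by (simp add: hom_part_def)

lemma hom_part_add: "hom_part g (a \<oplus>\<^bsub>F\<^esub> b) = hom_part g a \<oplus>\<^bsub>F\<^esub> hom_part g b"
  by (auto simp: hom_part_def fun_eq_iff)

lemma hom_part_minus:
  "a \<in> carrier F \<Longrightarrow> hom_part g (\<ominus>\<^bsub>F\<^esub> a) = \<ominus>\<^bsub>F\<^esub> hom_part g a"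
  by (simp add: R.free_algebra_a_inv) (auto simp: hom_part_def fun_eq_iff)

lemma hom_part_monomial:
  "hom_part g (monomial R r w) = (if deg w = g then monomial R r w else \<zero>\<^bsub>F\<^esub>)"
  by (auto simp: hom_part_def monomial_def fun_eq_iff)

lemma homogeneous_subgroup: "additive_subgroup (homogeneous g) F"
proof (rule F.additive_subgroup_intro)
  show "a \<oplus>\<^bsub>F\<^esub> b \<in> homogeneous g" if "a \<in> homogeneous g" "b \<in> homogeneous g" for a b
  proof -
    have "deg w = g" if "a w \<oplus>\<^bsub>R\<^esub> b w \<noteq> \<zero>\<^bsub>R\<^esub>" for w
    proof (rule ccontr)
      assume "deg w \<noteq> g"
      then have "a w = \<zero>\<^bsub>R\<^esub>" "b w = \<zero>\<^bsub>R\<^esub>"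
        using \<open>a \<in> _\<close> \<open>b \<in> _\<close> unfolding homogeneous_def by blast+
      then show False using that by simp
    qed
    moreover have "a \<in> carrier F" "b \<in> carrier F" using that by (simp_all add: homogeneous_def)
    ultimately show ?thesis
      using F.a_closed[of a b] by (simp add: homogeneous_def)
  qed
  show "\<ominus>\<^bsub>F\<^esub> a \<in> homogeneous g" if "a \<in> homogeneous g" for a
  proof -
    have "a \<in> carrier F" using that by (simp add: homogeneous_def)
    moreover have "deg w = g" if "\<ominus>\<^bsub>R\<^esub> a w \<noteq> \<zero>\<^bsub>R\<^esub>" for w
    proof -
      have "a w \<noteq> \<zero>\<^bsub>R\<^esub>" using that by auto
      then show ?thesis using \<open>a \<in> homogeneous g\<close> unfolding homogeneous_def by blast
    qed
    ultimately show ?thesis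
      using F.a_inv_closed[of a] by (simp add: homogeneous_def R.free_algebra_a_inv)
  qed
  show "\<zero>\<^bsub>F\<^esub> \<in> homogeneous g" using F.zero_closed by (simp add: homogeneous_def)
qed (auto simp: homogeneous_def)

lemma monomial_homogeneous:
  "r \<in> carrier R \<Longrightarrow> w \<in> lists X \<Longrightarrow> monomial R r w \<in> homogeneous (deg w)"
  using R.monomial_closed[of r w X] by (auto simp: homogeneous_def monomial_def)

lemma homogeneous_mult:
  assumes "a \<in> homogeneous g" "b \<in> homogeneous h"
  shows "a \<otimes>\<^bsub>F\<^esub> b \<in> homogeneous (g \<otimes>\<^bsub>G\<^esub> h)"
proof -
  have ab: "a \<in> carrier F" "b \<in> carrier F" using assms by (auto simp: homogeneous_def)
  have "deg w = g \<otimes>\<^bsub>G\<^esub> h" if w: "convolution R a b w \<noteq> \<zero>\<^bsub>R\<^esub>" for w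
  proof -
    obtain u v where "w = u @ v" "a u \<noteq> \<zero>\<^bsub>R\<^esub>" "b v \<noteq> \<zero>\<^bsub>R\<^esub>"
      using R.convolution_support[OF free_carrierD(1)[OF ab(1)] free_carrierD(1)[OF ab(2)] w]
      by blast
    then show ?thesis
      using assms ab free_carrierD(3) by (auto simp: homogeneous_def deg_append)
  qed
  then show ?thesis using F.m_closed[OF ab] by (simp add: homogeneous_def)
qed

text \<open>Multiplication by a homogeneous element shifts degrees. Both sides are additive in \<open>a\<close>, so it is
enough to compare them on monomials.\<close>

lemma hom_part_mult_homogeneous:
  assumes a: "a \<in> carrier F" and b: "b \<in> homogeneous h" and h: "h \<in> carrier G" and g: "g \<in> carrier G"
  shows "hom_part g (a \<otimes>\<^bsub>F\<^esub> b) = hom_part (g \<otimes>\<^bsub>G\<^esub> inv\<^bsub>G\<^esub> h) a \<otimes>\<^bsub>F\<^esub> b"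
    and "hom_part g (b \<otimes>\<^bsub>F\<^esub> a) = b \<otimes>\<^bsub>F\<^esub> hom_part (inv\<^bsub>G\<^esub> h \<otimes>\<^bsub>G\<^esub> g) a"
proof -
  have b': "b \<in> carrier F" using b by (simp add: homogeneous_def)
  show "hom_part g (a \<otimes>\<^bsub>F\<^esub> b) = hom_part (g \<otimes>\<^bsub>G\<^esub> inv\<^bsub>G\<^esub> h) a \<otimes>\<^bsub>F\<^esub> b"
    using a
  proof (induction rule: R.free_algebra_induct)
    case zero
    then show ?case using F.l_null[OF b'] hom_part_zero by simp
  next
    case (monomial w)
    have w: "w \<in> lists X" "a w \<in> carrier R" using free_carrierD[OF a] monomial by auto
    have "g = deg w \<otimes>\<^bsub>G\<^esub> h \<longleftrightarrow> deg w = g \<otimes>\<^bsub>G\<^esub> inv\<^bsub>G\<^esub> h"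
      using deg_closed[OF w(1)] g h by (metis G.inv_solve_right)
    then show ?case
      using hom_part_of_homogeneous[OF homogeneous_mult[OF monomial_homogeneous[OF w(2,1)] b], of g]
        F.l_null[OF b'] by (auto simp: hom_part_monomial)
  next
    case (add p q)
    then show ?case
      using F.l_distr[of p q b] F.l_distr[of "hom_part k p" "hom_part k q" b for k] b'
        hom_part_add[of _ p q] hom_part_add[of g "p \<otimes>\<^bsub>F\<^esub> b" "q \<otimes>\<^bsub>F\<^esub> b"] by simp
  qed
  show "hom_part g (b \<otimes>\<^bsub>F\<^esub> a) = b \<otimes>\<^bsub>F\<^esub> hom_part (inv\<^bsub>G\<^esub> h \<otimes>\<^bsub>G\<^esub> g) a"
    using a
  proof (induction rule: R.free_algebra_induct)
    case zero
    then show ?case using F.r_null[OF b'] hom_part_zero by simp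
  next
    case (monomial w)
    have w: "w \<in> lists X" "a w \<in> carrier R" using free_carrierD[OF a] monomial by auto
    have "g = h \<otimes>\<^bsub>G\<^esub> deg w \<longleftrightarrow> deg w = inv\<^bsub>G\<^esub> h \<otimes>\<^bsub>G\<^esub> g"
      using deg_closed[OF w(1)] g h by (metis G.inv_solve_left)
    then show ?case
      using hom_part_of_homogeneous[OF homogeneous_mult[OF b monomial_homogeneous[OF w(2,1)]], of g]
        F.r_null[OF b'] by (auto simp: hom_part_monomial)
  next
    case (add p q)
    then show ?case
      using F.r_distr[of p q b] F.r_distr[of "hom_part k p" "hom_part k q" b for k] b'
        hom_part_add[of _ p q] hom_part_add[of g "b \<otimes>\<^bsub>F\<^esub> p" "b \<otimes>\<^bsub>F\<^esub> q"] by simp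
  qed
qed

text \<open>All relators have the degree of a vertex, except those that fix the ends of an edge or ghost edge,
which have the degree of that edge or ghost edge, and those consisting of a single word, which have
the degree of this word.\<close>

lemma relator_homogeneous:
  assumes "a \<in> lpa_relators R E"
  shows "\<exists>h \<in> carrier G. a \<in> homogeneous h"
proof -
  have mon: "word_monom R w \<in> homogeneous (deg w)" if "w \<in> lists X" for w
    using monomial_homogeneous[OF _ that, of "\<one>\<^bsub>R\<^esub>"] by (simp add: word_monom_eq_monomial)
  have zero: "\<zero>\<^bsub>F\<^esub> \<in> homogeneous h" for h by (rule F.additive_subgroupD(2)[OF homogeneous_subgroup])
  have diff: "b \<ominus>\<^bsub>F\<^esub> c \<in> homogeneous h" if "b \<in> homogeneous h" "c \<in> homogeneous h" for b c h
    unfolding a_minus_def using that F.additive_subgroupD(3,4)[OF homogeneous_subgroup] by blast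
  have gens: "Vertex v \<in> X" if "v \<in> verts E" for v
    using that by (simp add: lpa_gens_def)
  have gens': "Edge f \<in> X" "Ghost f \<in> X" "d f \<in> carrier G" if "f \<in> arcs E" for f
    using that arc_degree by (auto simp: lpa_gens_def)
  have one: "\<one>\<^bsub>G\<^esub> \<in> carrier G" by simp
  have inv_degree: "inv\<^bsub>G\<^esub> d f \<in> carrier G" if "f \<in> arcs E" for f
    using gens'(3)[OF that] by simp
  consider
      (vv) u v where "u \<in> verts E" "v \<in> verts E" "a = word_monom R [Vertex u, Vertex v] \<ominus>\<^bsub>F\<^esub> (if u = v then word_monom R [Vertex v] else \<zero>\<^bsub>F\<^esub>)"
    | (te) f where "f \<in> arcs E" "a = word_monom R [Vertex (tail E f), Edge f] \<ominus>\<^bsub>F\<^esub> word_monom R [Edge f]"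
    | (eh) f where "f \<in> arcs E" "a = word_monom R [Edge f, Vertex (head E f)] \<ominus>\<^bsub>F\<^esub> word_monom R [Edge f]"
    | (hg) f where "f \<in> arcs E" "a = word_monom R [Vertex (head E f), Ghost f] \<ominus>\<^bsub>F\<^esub> word_monom R [Ghost f]"
    | (gt) f where "f \<in> arcs E" "a = word_monom R [Ghost f, Vertex (tail E f)] \<ominus>\<^bsub>F\<^esub> word_monom R [Ghost f]"
    | (ge) f f' where "f \<in> arcs E" "f' \<in> arcs E" "a = word_monom R [Ghost f, Edge f'] \<ominus>\<^bsub>F\<^esub> (if f = f' then word_monom R [Vertex (head E f)] else \<zero>\<^bsub>F\<^esub>)"
    | (sum) v where "v \<in> verts E" "finite (out_arcs E v)" "a = (\<Oplus>\<^bsub>F\<^esub> f \<in> out_arcs E v. word_monom R [Edge f, Ghost f]) \<ominus>\<^bsub>F\<^esub> word_monom R [Vertex v]"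
    using assms unfolding lpa_relators_def Let_def Un_iff mem_Collect_eq by blast
  then show ?thesis
  proof cases
    case vv
    have "word_monom R [Vertex u, Vertex v] \<in> homogeneous \<one>\<^bsub>G\<^esub>"
      "(if u = v then word_monom R [Vertex v] else \<zero>\<^bsub>F\<^esub>) \<in> homogeneous \<one>\<^bsub>G\<^esub>"
      using vv mon[of "[Vertex u, Vertex v]"] mon[of "[Vertex v]"] gens zero[of "\<one>\<^bsub>G\<^esub>"] by auto
    then show ?thesis using vv(3) diff one by blast
  next
    case te
    have "word_monom R [Vertex (tail E f), Edge f] \<in> homogeneous (d f)"
      "word_monom R [Edge f] \<in> homogeneous (d f)"
      using te mon[of "[Vertex (tail E f), Edge f]"] mon[of "[Edge f]"] gens gens' by auto
    then show ?thesis using te diff gens'(3) by blast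
  next
    case eh
    have "word_monom R [Edge f, Vertex (head E f)] \<in> homogeneous (d f)"
      "word_monom R [Edge f] \<in> homogeneous (d f)"
      using eh mon[of "[Edge f, Vertex (head E f)]"] mon[of "[Edge f]"] gens gens' by auto
    then show ?thesis using eh diff gens'(3) by blast
  next
    case hg
    have "word_monom R [Vertex (head E f), Ghost f] \<in> homogeneous (inv\<^bsub>G\<^esub> d f)"
      "word_monom R [Ghost f] \<in> homogeneous (inv\<^bsub>G\<^esub> d f)"
      using hg mon[of "[Vertex (head E f), Ghost f]"] mon[of "[Ghost f]"] gens gens' by auto
    then show ?thesis using hg diff inv_degree by blast
  next
    case gt
    have "word_monom R [Ghost f, Vertex (tail E f)] \<in> homogeneous (inv\<^bsub>G\<^esub> d f)"
      "word_monom R [Ghost f] \<in> homogeneous (inv\<^bsub>G\<^esub> d f)"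
      using gt mon[of "[Ghost f, Vertex (tail E f)]"] mon[of "[Ghost f]"] gens gens' by auto
    then show ?thesis using gt diff inv_degree by blast
  next
    case ge
    have w: "[Ghost f, Edge f'] \<in> lists X" using gens' ge by simp
    show ?thesis
    proof (cases "f = f'")
      case True
      have "word_monom R [Ghost f, Edge f'] \<in> homogeneous \<one>\<^bsub>G\<^esub>"
        "word_monom R [Vertex (head E f)] \<in> homogeneous \<one>\<^bsub>G\<^esub>"
        using ge True mon[OF w] mon[of "[Vertex (head E f)]"] gens gens' by auto
      then show ?thesis using ge True diff one by auto
    next
      case False
      show ?thesis
        using ge False diff[OF mon[OF w] zero] deg_closed[OF w] by auto
    qed
  next
    case sum
    have "word_monom R [Edge f, Ghost f] \<in> homogeneous \<one>\<^bsub>G\<^esub>" if "f \<in> out_arcs E v" for f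
      using mon[of "[Edge f, Ghost f]"] gens' that by simp
    then have "(\<Oplus>\<^bsub>F\<^esub> f \<in> out_arcs E v. word_monom R [Edge f, Ghost f]) \<in> homogeneous \<one>\<^bsub>G\<^esub>"
      using sum(2) by (intro F.additive_subgroup_finsum[OF homogeneous_subgroup])
    then show ?thesis using sum diff[of _ "\<one>\<^bsub>G\<^esub>"] mon[of "[Vertex v]"] gens one by auto
  qed
qed

sublocale I: ideal I F
  unfolding lpa_ideal_def
  using relator_homogeneous by (intro F.genideal_ideal) (auto simp: homogeneous_def)

sublocale Q: ring Q by (rule I.quotient_is_ring)

text \<open>The elements of the free algebra all of whose homogeneous parts lie in the ideal form themselves an
ideal, and it contains the relators because each relator is homogeneous. Closure under
multiplication is checked on monomials, where \<open>hom_part_mult_homogeneous\<close> applies.\<close>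

lemma lpa_ideal_homogeneous:
  assumes "a \<in> I" "g \<in> carrier G"
  shows "hom_part g a \<in> I"
proof -
  let ?J = "{a \<in> carrier F. \<forall>g\<in>carrier G. hom_part g a \<in> I}"
  have I_closed: "a \<oplus>\<^bsub>F\<^esub> b \<in> I" if "a \<in> I" "b \<in> I" for a b
    using that by (rule I.a_closed)
  have sum_closed: "p \<oplus>\<^bsub>F\<^esub> q \<in> ?J" if "p \<in> ?J" "q \<in> ?J" for p q
    using that by (simp add: hom_part_add I_closed F.a_closed del: free_algebra_simps)
  have mult_closed: "(a \<otimes>\<^bsub>F\<^esub> x \<in> ?J) \<and> (x \<otimes>\<^bsub>F\<^esub> a \<in> ?J)" if a: "a \<in> ?J" and x: "x \<in> carrier F" for a x
    using x
  proof (induction rule: R.free_algebra_induct)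
    case zero
    then show ?case
      using a F.l_null[of a] F.r_null[of a] hom_part_zero F.zero_closed I.zero_closed by simp
  next
    case (monomial w)
    have w: "w \<in> lists X" "x w \<in> carrier R" using free_carrierD[OF x] monomial by auto
    let ?m = "monomial R (x w) w"
    have m: "?m \<in> homogeneous (deg w)" "?m \<in> carrier F"
      using monomial_homogeneous[OF w(2,1)] by (auto simp: homogeneous_def)
    have "hom_part k (a \<otimes>\<^bsub>F\<^esub> ?m) \<in> I \<and> hom_part k (?m \<otimes>\<^bsub>F\<^esub> a) \<in> I" if k: "k \<in> carrier G" for k
    proof -
      let ?k = "k \<otimes>\<^bsub>G\<^esub> inv\<^bsub>G\<^esub> deg w" and ?k' = "inv\<^bsub>G\<^esub> deg w \<otimes>\<^bsub>G\<^esub> k"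
      have "?k \<in> carrier G" "?k' \<in> carrier G" using k deg_closed[OF w(1)] by simp_all
      then have "hom_part ?k a \<otimes>\<^bsub>F\<^esub> ?m \<in> I" "?m \<otimes>\<^bsub>F\<^esub> hom_part ?k' a \<in> I"
        using a m(2) I.I_l_closed I.I_r_closed by blast+
      then show ?thesis
        using hom_part_mult_homogeneous[OF _ m(1) deg_closed[OF w(1)] k, of a] a
        by (simp del: free_algebra_simps)
    qed
    then show ?case using a m(2) by (auto simp del: free_algebra_simps)
  next
    case (add b c)
    have a': "a \<in> carrier F" using a by simp
    have "a \<otimes>\<^bsub>F\<^esub> (b \<oplus>\<^bsub>F\<^esub> c) \<in> ?J"
      unfolding F.r_distr[OF add.hyps a'] using add.IH by (intro sum_closed) (erule conjunct1)+
    moreover have "(b \<oplus>\<^bsub>F\<^esub> c) \<otimes>\<^bsub>F\<^esub> a \<in> ?J"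
      unfolding F.l_distr[OF add.hyps a'] using add.IH by (intro sum_closed) (erule conjunct2)+
    ultimately have "a \<otimes>\<^bsub>F\<^esub> (b \<oplus>\<^bsub>F\<^esub> c) \<in> ?J \<and> (b \<oplus>\<^bsub>F\<^esub> c) \<otimes>\<^bsub>F\<^esub> a \<in> ?J" ..
    then show ?case by simp
  qed
  have "ideal ?J F"
  proof (rule idealI)
    have "additive_subgroup ?J F"
      by (rule F.additive_subgroup_intro)
        (auto simp: hom_part_add hom_part_minus hom_part_zero I_closed I.zero_closed
          simp del: free_algebra_simps intro: I.a_inv_closed)
    then show "subgroup ?J (add_monoid F)" by (rule additive_subgroup.a_subgroup)
  qed (use mult_closed F.ring_axioms in auto)
  moreover have "lpa_relators R E \<subseteq> ?J"
  proof
    fix b assume b: "b \<in> lpa_relators R E"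
    obtain h where h: "b \<in> homogeneous h" using relator_homogeneous[OF b] by blast
    have "b \<in> I"
      using b F.genideal_self[of "lpa_relators R E"] relator_homogeneous
      by (auto simp: lpa_ideal_def homogeneous_def)
    then show "b \<in> ?J"
      using hom_part_of_homogeneous[OF h] I.zero_closed I.Icarr by (auto simp del: free_algebra_simps)
  qed
  ultimately have "I \<subseteq> ?J" unfolding lpa_ideal_def[of R E] by (rule F.genideal_minimal)
  then show ?thesis using assms by auto
qed

end

section \<open>The gradation of the Leavitt path algebra\<close>

context leavitt_grading
begin

\<comment> \<open>From here on the operations of the free algebra are manipulated through the ring axioms and the
  quotient homomorphism, whose simplification rules need them in folded form.\<close>
declare free_algebra_simps [simp del]

sublocale cls: ring_hom_ring F Q "(+>\<^bsub>F\<^esub>) I" by (rule I.rcos_ring_hom_ring)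

lemma cls_eq_iff:
  assumes "a \<in> carrier F" "b \<in> carrier F"
  shows "cls a = cls b \<longleftrightarrow> a \<ominus>\<^bsub>F\<^esub> b \<in> I"
proof -
  \<comment> \<open>\<open>I\<close> occurs in \<open>Q\<close>, so this equation must not reach the simplifier as a rewrite rule.\<close>
  have zero: "\<zero>\<^bsub>Q\<^esub> = I" by (simp only: FactRing_def ring.simps)
  have "cls c = \<zero>\<^bsub>Q\<^esub> \<longleftrightarrow> c \<in> I" if "c \<in> carrier F" for c
  proof
    assume "cls c = \<zero>\<^bsub>Q\<^esub>"
    then have "cls c = I" using zero by (rule trans)
    with I.a_rcos_self[OF that] show "c \<in> I" by (rule subst[rotated])
  next
    assume "c \<in> I"
    then have "cls c = I" by (rule F.a_coset_join2[OF that I.a_subgroup])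
    then show "cls c = \<zero>\<^bsub>Q\<^esub>" using zero[symmetric] by (rule trans)
  qed
  from this[OF F.minus_closed[OF assms]]
  have "a \<ominus>\<^bsub>F\<^esub> b \<in> I \<longleftrightarrow> cls (a \<ominus>\<^bsub>F\<^esub> b) = \<zero>\<^bsub>Q\<^esub>" by blast
  also have "cls (a \<ominus>\<^bsub>F\<^esub> b) = cls a \<ominus>\<^bsub>Q\<^esub> cls b"
    using assms by (simp add: a_minus_def)
  also have "\<dots> = \<zero>\<^bsub>Q\<^esub> \<longleftrightarrow> cls a = cls b"
    using assms by (intro Q.minus_eq_zero_iff cls.hom_closed)
  finally show ?thesis by blast
qed

lemma cls_hom_part_cong:
  assumes "a \<in> carrier F" "b \<in> carrier F" "g \<in> carrier G" "cls a = cls b"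
  shows "cls (hom_part g a) = cls (hom_part g b)"
proof -
  have "hom_part g (a \<ominus>\<^bsub>F\<^esub> b) = hom_part g a \<ominus>\<^bsub>F\<^esub> hom_part g b"
    using assms by (simp add: a_minus_def hom_part_add hom_part_minus)
  then show ?thesis using assms lpa_ideal_homogeneous[of "a \<ominus>\<^bsub>F\<^esub> b" g] by (simp add: cls_eq_iff)
qed

lemma N_iff: "a \<in> N \<longleftrightarrow> a \<in> carrier F \<and> a [] = \<zero>\<^bsub>R\<^esub>"
  by (simp add: nonunital_part_def)

lemma N_closed [simp]: "a \<in> N \<Longrightarrow> a \<in> carrier F"
  by (simp add: N_iff)

lemma N_subgroup: "additive_subgroup N F"
  by (rule F.additive_subgroup_intro) (auto simp: N_iff R.free_algebra_a_inv R.free_algebra_minus_closed,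
      auto simp: free_algebra_simps)

lemma N_mult: "a \<in> N \<Longrightarrow> b \<in> N \<Longrightarrow> a \<otimes>\<^bsub>F\<^esub> b \<in> N"
  using F.m_closed[of a b] R.convolution_Nil[of a b]
  by (simp add: N_iff free_carrierD) (simp add: free_algebra_simps)

lemma component_eq: "component g = cls ` (N \<inter> homogeneous g)"
  by (auto simp: standard_gradation_def homogeneous_def)

lemma L_simps [simp]:
  "carrier L = cls ` N" "mult L = mult Q" "add L = add Q" "zero L = zero Q"
  by (simp_all add: leavitt_path_algebra_def)

lemma L_eq: "L = Q\<lparr>carrier := cls ` N\<rparr>"
  by (simp add: leavitt_path_algebra_def)

lemma cls_image_subgroup: "additive_subgroup H F \<Longrightarrow> additive_subgroup (cls ` H) Q"
  using cls.img_is_add_subgroup[OF additive_subgroup.a_subgroup] by (rule additive_subgroup.intro)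

lemma L_nonunital_ring: "nonunital_ring L"
  unfolding L_eq
proof (rule nonunital_ring.nonunital_ring_carrier_update[OF Q.nonunital_ring])
  show "additive_subgroup (cls ` N) Q" by (rule cls_image_subgroup[OF N_subgroup])
  fix x y assume "x \<in> cls ` N" "y \<in> cls ` N"
  then obtain a b where "a \<in> N" "b \<in> N" "x = cls a" "y = cls b" by blast
  then show "x \<otimes>\<^bsub>Q\<^esub> y \<in> cls ` N" using N_mult[of a b] by (auto simp flip: cls.hom_mult)
qed

lemma component_subgroup: "additive_subgroup (component g) L"
proof -
  have "additive_subgroup (N \<inter> homogeneous g) F"
    using F.additive_subgroupD[OF N_subgroup] F.additive_subgroupD[OF homogeneous_subgroup[of g]]
    by (intro F.additive_subgroup_intro) auto
  then show ?thesis
    unfolding component_eq L_eq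
    by (intro Q.additive_subgroup_carrier_update cls_image_subgroup N_subgroup) auto
qed

text \<open>The map induced by \<open>hom_part g\<close> on the quotient, computed on an arbitrary representative.\<close>

definition proj :: "'g \<Rightarrow> (('v, 'e) lpa_gen list \<Rightarrow> 'r) set \<Rightarrow> (('v, 'e) lpa_gen list \<Rightarrow> 'r) set" where
  "proj g x = cls (hom_part g (SOME a. a \<in> N \<and> cls a = x))"

lemma proj_cls:
  assumes "a \<in> N" "g \<in> carrier G"
  shows "proj g (cls a) = cls (hom_part g a)"
proof -
  have "(SOME b. b \<in> N \<and> cls b = cls a) \<in> N \<and> cls (SOME b. b \<in> N \<and> cls b = cls a) = cls a"
    by (rule someI[of "\<lambda>b. b \<in> N \<and> cls b = cls a" a]) (use assms in simp)
  then show ?thesis unfolding proj_def using assms by (intro cls_hom_part_cong) auto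
qed

lemma hom_part_N: "a \<in> N \<Longrightarrow> hom_part g a \<in> N"
  by (simp add: N_iff) (simp add: hom_part_def)

lemma cls_eq_sum_hom_parts:
  assumes "finite K" "K \<subseteq> carrier G" "a \<in> N" "\<And>w. a w \<noteq> \<zero>\<^bsub>R\<^esub> \<Longrightarrow> deg w \<in> K"
  shows "cls a = (\<Oplus>\<^bsub>L\<^esub>g\<in>K. cls (hom_part g a))"
  using assms
proof (induction K arbitrary: a)
  case empty
  interpret L: nonunital_ring L by (rule L_nonunital_ring)
  from empty have "a = \<zero>\<^bsub>F\<^esub>" by (auto simp: free_algebra_simps)
  then show ?case using cls.hom_zero by simp
next
  case (insert k K)
  interpret L: nonunital_ring L by (rule L_nonunital_ring)
  let ?b = "\<lambda>w. if deg w \<noteq> k then a w else \<zero>\<^bsub>R\<^esub>"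
  have a: "a \<in> carrier F" using insert.prems by simp
  have b: "?b \<in> N"
    using insert.prems R.free_algebra_restrict_closed[OF a, of "\<lambda>w. deg w \<noteq> k"] by (simp add: N_iff)
  have parts: "hom_part g ?b = hom_part g a" if "g \<in> K" for g
    using that insert.hyps by (auto simp: hom_part_def fun_eq_iff)
  have ab: "a = hom_part k a \<oplus>\<^bsub>F\<^esub> ?b"
    using free_carrierD(1)[OF a] by (auto simp: free_algebra_simps hom_part_def fun_eq_iff)
  have in_L: "(\<lambda>g. cls (hom_part g a)) \<in> K \<rightarrow> carrier L" and in_L': "cls (hom_part k a) \<in> carrier L"
    using hom_part_N[OF insert.prems(2)] by auto
  have "cls ?b = (\<Oplus>\<^bsub>L\<^esub>g\<in>K. cls (hom_part g ?b))"
    using insert.prems b by (intro insert.IH) (auto split: if_splits)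
  also have "\<dots> = (\<Oplus>\<^bsub>L\<^esub>g\<in>K. cls (hom_part g a))"
    using in_L by (rule L.finsum_cong'[OF refl]) (simp only: parts)
  finally have b_sum: "cls ?b = (\<Oplus>\<^bsub>L\<^esub>g\<in>K. cls (hom_part g a))" .
  have "cls a = cls (hom_part k a \<oplus>\<^bsub>F\<^esub> ?b)" using ab by (rule arg_cong)
  also have "\<dots> = cls (hom_part k a) \<oplus>\<^bsub>Q\<^esub> cls ?b"
    by (rule cls.hom_add[OF hom_part_closed[OF a] N_closed[OF b]])
  also have "\<dots> = cls (hom_part k a) \<oplus>\<^bsub>Q\<^esub> (\<Oplus>\<^bsub>L\<^esub>g\<in>K. cls (hom_part g a))"
    by (simp only: b_sum)
  also have "\<dots> = (\<Oplus>\<^bsub>L\<^esub>g\<in>insert k K. cls (hom_part g a))"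
    unfolding L.finsum_insert[OF insert.hyps(1,2) in_L in_L'] by (simp only: L_simps)
  finally show ?case .
qed

lemma L_graded_ring: "graded_ring L G component"
proof (rule graded_ring_if_projections[where \<pi> = proj])
  show "nonunital_ring L" by (rule L_nonunital_ring)
  show "group G" by (rule G.group_axioms)
  show "additive_subgroup (component g) L" for g by (rule component_subgroup)
  fix g assume g: "g \<in> carrier G"
  show "x \<otimes>\<^bsub>L\<^esub> y \<in> component (g \<otimes>\<^bsub>G\<^esub> h)"
    if "x \<in> component g" "y \<in> component h" for x y h
  proof -
    obtain a b where "a \<in> N \<inter> homogeneous g" "b \<in> N \<inter> homogeneous h" "x = cls a" "y = cls b"
      using \<open>x \<in> _\<close> \<open>y \<in> _\<close> unfolding component_eq by blast
    then show ?thesis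
      unfolding component_eq using N_mult[of a b] homogeneous_mult[of a g b h]
      by (auto simp flip: cls.hom_mult)
  qed
  show "proj g x \<in> component g" if "x \<in> carrier L" for x
    using that g hom_part_homogeneous hom_part_N by (auto simp: proj_cls component_eq)
  show "proj g (x \<oplus>\<^bsub>L\<^esub> y) = proj g x \<oplus>\<^bsub>L\<^esub> proj g y" if "x \<in> carrier L" "y \<in> carrier L" for x y
  proof -
    obtain a b where ab: "a \<in> N" "b \<in> N" "x = cls a" "y = cls b" using \<open>x \<in> _\<close> \<open>y \<in> _\<close> by auto
    then have "a \<oplus>\<^bsub>F\<^esub> b \<in> N" using F.additive_subgroupD(3)[OF N_subgroup] by blast
    then have "proj g (cls (a \<oplus>\<^bsub>F\<^esub> b)) = cls (hom_part g (a \<oplus>\<^bsub>F\<^esub> b))"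
      using g by (rule proj_cls)
    then show ?thesis using ab g by (simp add: hom_part_add proj_cls)
  qed
  show "proj g x = x" if "x \<in> component g" for x
    using that g by (auto simp: component_eq proj_cls hom_part_of_homogeneous)
  show "proj g x = \<zero>\<^bsub>L\<^esub>" if "g \<noteq> h" "x \<in> component h" for h x
    using that g cls.hom_zero by (auto simp: component_eq proj_cls hom_part_of_homogeneous)
next
  fix x assume "x \<in> carrier L"
  then obtain a where a: "a \<in> N" "x = cls a" by auto
  let ?K = "deg ` {w. a w \<noteq> \<zero>\<^bsub>R\<^esub>}"
  have K: "finite ?K" "?K \<subseteq> carrier G"
    using free_carrierD[of a] a(1) deg_closed by auto
  interpret L: nonunital_ring L by (rule L_nonunital_ring)
  have "x = (\<Oplus>\<^bsub>L\<^esub>g\<in>?K. cls (hom_part g a))"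
    using cls_eq_sum_hom_parts[OF K a(1)] a(2) by simp
  also have "\<dots> = (\<Oplus>\<^bsub>L\<^esub>g\<in>?K. proj g x)"
    using K a hom_part_N by (intro L.finsum_cong') (auto simp: proj_cls)
  finally show "\<exists>K. finite K \<and> K \<subseteq> carrier G \<and> x = (\<Oplus>\<^bsub>L\<^esub>g\<in>K. proj g x)" using K by blast
qed

end

section \<open>Local units in the components\<close>

context leavitt_grading
begin

lemma cls_relator:
  assumes "b \<ominus>\<^bsub>F\<^esub> c \<in> lpa_relators R E" "b \<in> carrier F" "c \<in> carrier F"
  shows "cls b = cls c"
proof -
  have "lpa_relators R E \<subseteq> carrier F" using relator_homogeneous by (auto simp: homogeneous_def)
  then have "b \<ominus>\<^bsub>F\<^esub> c \<in> I"
    using assms(1) F.genideal_self unfolding lpa_ideal_def by blast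
  then show ?thesis using assms by (simp add: cls_eq_iff)
qed

abbreviation "\<gamma> x \<equiv> cls (monomial R \<one>\<^bsub>R\<^esub> [x])"

sublocale cohn_family Q E \<gamma>
proof unfold_locales
  have mon: "word_monom R w \<in> carrier F" if "w \<in> lists X" for w
    using R.monomial_closed[OF R.one_closed that] by (simp add: word_monom_eq_monomial)
  have prod: "\<gamma> x \<otimes>\<^bsub>Q\<^esub> \<gamma> y = cls (word_monom R [x, y])" if "x \<in> X" "y \<in> X" for x y
    using that R.monomial_closed[OF R.one_closed, of "[x]" X] R.monomial_closed[OF R.one_closed, of "[y]" X]
    by (simp add: free_algebra_simps R.monomial_mult word_monom_eq_monomial flip: cls.hom_mult)
  have gens: "Vertex v \<in> X" if "v \<in> verts E" for v using that by (simp add: lpa_gens_def)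
  have gens': "Edge f \<in> X" "Ghost f \<in> X" if "f \<in> arcs E" for f using that by (auto simp: lpa_gens_def)
  show "\<gamma> x \<in> carrier Q" if "x \<in> X" for x
    using that by (intro cls.hom_closed R.monomial_closed) auto
  show "\<gamma> (Vertex u) \<otimes>\<^bsub>Q\<^esub> \<gamma> (Vertex v) = (if u = v then \<gamma> (Vertex v) else \<zero>\<^bsub>Q\<^esub>)"
    if "u \<in> verts E" "v \<in> verts E" for u v
  proof -
    have "cls (word_monom R [Vertex u, Vertex v])
        = cls (if u = v then word_monom R [Vertex v] else \<zero>\<^bsub>F\<^esub>)"
      by (rule cls_relator)
        (use that gens mon in \<open>auto simp: lpa_relators_def Let_def\<close>)
    then show ?thesis using that gens prod cls.hom_zero by (auto simp: word_monom_eq_monomial)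
  qed
  show "\<gamma> (Vertex (tail E f)) \<otimes>\<^bsub>Q\<^esub> \<gamma> (Edge f) = \<gamma> (Edge f)" if "f \<in> arcs E" for f
  proof -
    have "cls (word_monom R [Vertex (tail E f), Edge f]) = cls (word_monom R [Edge f])"
      by (rule cls_relator) (use that gens gens' mon in \<open>auto simp: lpa_relators_def Let_def\<close>)
    then show ?thesis using that gens gens' prod by (simp add: word_monom_eq_monomial)
  qed
  show "\<gamma> (Edge f) \<otimes>\<^bsub>Q\<^esub> \<gamma> (Vertex (head E f)) = \<gamma> (Edge f)" if "f \<in> arcs E" for f
  proof -
    have "cls (word_monom R [Edge f, Vertex (head E f)]) = cls (word_monom R [Edge f])"
      by (rule cls_relator) (use that gens gens' mon in \<open>auto simp: lpa_relators_def Let_def\<close>)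
    then show ?thesis using that gens gens' prod by (simp add: word_monom_eq_monomial)
  qed
  show "\<gamma> (Vertex (head E f)) \<otimes>\<^bsub>Q\<^esub> \<gamma> (Ghost f) = \<gamma> (Ghost f)" if "f \<in> arcs E" for f
  proof -
    have "cls (word_monom R [Vertex (head E f), Ghost f]) = cls (word_monom R [Ghost f])"
      by (rule cls_relator) (use that gens gens' mon in \<open>auto simp: lpa_relators_def Let_def\<close>)
    then show ?thesis using that gens gens' prod by (simp add: word_monom_eq_monomial)
  qed
  show "\<gamma> (Ghost f) \<otimes>\<^bsub>Q\<^esub> \<gamma> (Vertex (tail E f)) = \<gamma> (Ghost f)" if "f \<in> arcs E" for f
  proof -
    have "cls (word_monom R [Ghost f, Vertex (tail E f)]) = cls (word_monom R [Ghost f])"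
      by (rule cls_relator) (use that gens gens' mon in \<open>auto simp: lpa_relators_def Let_def\<close>)
    then show ?thesis using that gens gens' prod by (simp add: word_monom_eq_monomial)
  qed
  show "\<gamma> (Ghost f) \<otimes>\<^bsub>Q\<^esub> \<gamma> (Edge f') = (if f = f' then \<gamma> (Vertex (head E f)) else \<zero>\<^bsub>Q\<^esub>)"
    if "f \<in> arcs E" "f' \<in> arcs E" for f f'
  proof -
    have "cls (word_monom R [Ghost f, Edge f'])
        = cls (if f = f' then word_monom R [Vertex (head E f)] else \<zero>\<^bsub>F\<^esub>)"
      by (rule cls_relator) (use that gens gens' mon in \<open>auto simp: lpa_relators_def Let_def\<close>)
    then show ?thesis using that gens gens' prod cls.hom_zero by (auto simp: word_monom_eq_monomial)
  qed
qed

lemma word_prod_eq_cls: "w \<in> lists X \<Longrightarrow> word_prod w = cls (monomial R \<one>\<^bsub>R\<^esub> w)"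
proof (induction w)
  case Nil
  then show ?case using cls.hom_one by (simp add: free_algebra_simps)
next
  case (Cons x w)
  then show ?case
    using R.monomial_closed[OF R.one_closed, of "[x]" X] R.monomial_closed[OF R.one_closed, of w X]
    by (simp add: free_algebra_simps R.monomial_mult flip: cls.hom_mult)
qed

lemma word_in_component:
  assumes "w \<in> lists X" "w \<noteq> []"
  shows "word_prod w \<in> component (deg w)"
  using assms monomial_homogeneous[OF R.one_closed assms(1)] R.monomial_closed[OF R.one_closed assms(1)]
  unfolding component_eq word_prod_eq_cls[OF assms(1)]
  by (auto simp: N_iff monomial_def intro!: imageI)

lemma deg_adjoint: "w \<in> lists X \<Longrightarrow> deg (word_adjoint w) = inv\<^bsub>G\<^esub> deg w"
proof (induction w)
  case (Cons x w)
  have x: "x \<in> X" "gen_degree G d (gen_adjoint x) = inv\<^bsub>G\<^esub> gen_degree G d x"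
    using Cons.prems arc_degree by (cases x; auto simp: lpa_gens_def Pi_iff)+
  then show ?case
    using Cons by (simp add: word_adjoint_Cons deg_append gen_degree_closed deg_closed
        G.inv_mult_group del: in_lists_conv_set)
qed (simp add: word_adjoint_def)

text \<open>The join of the projections \<open>w w\<^sup>*\<close> is a left unit for the words \<open>w\<close>, because \<open>w = (w w\<^sup>*) w\<close>, and for the
same reason a right unit for the words \<open>w\<^sup>*\<close>.\<close>

lemma word_local_unit:
  assumes "g \<in> carrier G" "finite W" "W \<subseteq> lists X" "\<And>w. w \<in> W \<Longrightarrow> w \<noteq> [] \<and> deg w = g"
  shows "\<exists>t \<in> component g \<cdot>\<^bsub>L\<^esub> component (inv\<^bsub>G\<^esub> g).
    \<forall>w\<in>W. t \<otimes>\<^bsub>Q\<^esub> word_prod w = word_prod w \<and> word_prod (word_adjoint w) \<otimes>\<^bsub>Q\<^esub> t = word_prod (word_adjoint w)"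
proof -
  interpret L: graded_ring L G component by (rule L_graded_ring)
  let ?T = "component g \<cdot>\<^bsub>L\<^esub> component (inv\<^bsub>G\<^esub> g)"
  let ?p = "\<lambda>w. word_prod w \<otimes>\<^bsub>Q\<^esub> word_prod (word_adjoint w)"
  have W: "w \<in> lists X" "word_adjoint w \<in> lists X" "w \<noteq> []" "word_adjoint w \<noteq> []" "deg w = g"
    if "w \<in> W" for w
    using that assms(3,4) by (auto simp: subset_iff simp del: in_lists_conv_set)
  have proj: "?p w \<in> projections" if "w \<in> W" for w
    using W[OF that] by (intro word_range_projection)
  have T: "additive_subgroup ?T L"
    using assms(1) by (intro L.S.ideal_prod_subgroup component_subgroup)
  have "\<exists>t\<in>?T. \<forall>p\<in>?p ` W. t \<otimes>\<^bsub>L\<^esub> p = p \<and> p \<otimes>\<^bsub>L\<^esub> t = p"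
  proof (rule L.S.join_of_commuting_idempotents[OF T])
    show "x \<otimes>\<^bsub>L\<^esub> y \<in> ?T" if "x \<in> ?T" "y \<in> ?T" for x y
      using assms(1) that by (rule L.component_prod_mult_closed)
    show "finite (?p ` W)" using assms(2) by simp
    show "?p ` W \<subseteq> ?T"
    proof (rule image_subsetI)
      fix w assume w: "w \<in> W"
      have "word_prod w \<in> component g" "word_prod (word_adjoint w) \<in> component (inv\<^bsub>G\<^esub> g)"
        using word_in_component[of w] word_in_component[of "word_adjoint w"] deg_adjoint[of w] W[OF w]
        by simp_all
      then show "?p w \<in> ?T" using ideal_prod.prod[of _ "component g" _ _ L] by simp
    qed
    show "p \<otimes>\<^bsub>L\<^esub> p = p" if p: "p \<in> ?p ` W" for p
    proof -
      obtain w where w: "w \<in> W" "p = ?p w" using p by blast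
      have "p \<otimes>\<^bsub>Q\<^esub> p = (?p w \<otimes>\<^bsub>Q\<^esub> word_prod w) \<otimes>\<^bsub>Q\<^esub> word_prod (word_adjoint w)"
        using W[OF w(1)] w(2) by (simp add: Q.m_assoc del: in_lists_conv_set)
      then show ?thesis using word_partial_isometry[OF W(1)[OF w(1)]] w(2) by simp
    qed
    show "p \<otimes>\<^bsub>L\<^esub> p' = p' \<otimes>\<^bsub>L\<^esub> p" if "p \<in> ?p ` W" "p' \<in> ?p ` W" for p p'
      using that proj projections_commute by auto
  qed
  then obtain t where t: "t \<in> ?T" "\<And>w. w \<in> W \<Longrightarrow> t \<otimes>\<^bsub>Q\<^esub> ?p w = ?p w \<and> ?p w \<otimes>\<^bsub>Q\<^esub> t = ?p w"
    by auto
  have tQ: "t \<in> carrier Q"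
  proof -
    have "t \<in> cls ` N" using t(1) L.S.additive_subgroupD(1)[OF T] by auto
    then show ?thesis by auto
  qed
  have "t \<otimes>\<^bsub>Q\<^esub> word_prod w = word_prod w
      \<and> word_prod (word_adjoint w) \<otimes>\<^bsub>Q\<^esub> t = word_prod (word_adjoint w)" if w: "w \<in> W" for w
  proof
    have iso: "word_prod w = ?p w \<otimes>\<^bsub>Q\<^esub> word_prod w"
      using word_partial_isometry[OF W(1)[OF w]] by simp
    have iso': "word_prod (word_adjoint w) = word_prod (word_adjoint w) \<otimes>\<^bsub>Q\<^esub> ?p w"
      using word_partial_isometry[OF W(2)[OF w]] W[OF w] by (simp add: Q.m_assoc del: in_lists_conv_set)
    have "t \<otimes>\<^bsub>Q\<^esub> (?p w \<otimes>\<^bsub>Q\<^esub> word_prod w) = (t \<otimes>\<^bsub>Q\<^esub> ?p w) \<otimes>\<^bsub>Q\<^esub> word_prod w"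
      using W[OF w] tQ by (simp add: Q.m_assoc del: in_lists_conv_set)
    then show "t \<otimes>\<^bsub>Q\<^esub> word_prod w = word_prod w" using t(2)[OF w] iso by simp
    have "(word_prod (word_adjoint w) \<otimes>\<^bsub>Q\<^esub> ?p w) \<otimes>\<^bsub>Q\<^esub> t = word_prod (word_adjoint w) \<otimes>\<^bsub>Q\<^esub> (?p w \<otimes>\<^bsub>Q\<^esub> t)"
      using W[OF w] tQ by (simp add: Q.m_assoc del: in_lists_conv_set)
    then show "word_prod (word_adjoint w) \<otimes>\<^bsub>Q\<^esub> t = word_prod (word_adjoint w)"
      using t(2)[OF w] iso' by simp
  qed
  then show ?thesis using t(1) by blast
qed

text \<open>A coefficient can be moved to either side of a word, hence away from the side on which a unit acts.\<close>

lemma monomial_eq_word_prod_coeff: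
  assumes "r \<in> carrier R" "w \<in> lists X"
  shows "cls (monomial R r w) = word_prod w \<otimes>\<^bsub>Q\<^esub> cls (monomial R r [])"
    and "cls (monomial R r w) = cls (monomial R r []) \<otimes>\<^bsub>Q\<^esub> word_prod w"
proof -
  have "monomial R r w = monomial R \<one>\<^bsub>R\<^esub> w \<otimes>\<^bsub>F\<^esub> monomial R r []"
    "monomial R r w = monomial R r [] \<otimes>\<^bsub>F\<^esub> monomial R \<one>\<^bsub>R\<^esub> w"
    using assms by (simp_all add: free_algebra_simps R.monomial_mult)
  moreover have "monomial R \<one>\<^bsub>R\<^esub> w \<in> carrier F" "monomial R r [] \<in> carrier F"
    using assms by (auto intro: R.monomial_closed)
  ultimately show "cls (monomial R r w) = word_prod w \<otimes>\<^bsub>Q\<^esub> cls (monomial R r [])"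
    and "cls (monomial R r w) = cls (monomial R r []) \<otimes>\<^bsub>Q\<^esub> word_prod w"
    using assms(2) by (metis cls.hom_mult word_prod_eq_cls)+
qed

text \<open>The support of a homogeneous representative is a finite set of nonempty words of degree \<open>g\<close>. The right
unit is the one that \<open>word_local_unit\<close> gives for their adjoints, which have inverse degree.\<close>

lemma component_local_units:
  assumes g: "g \<in> carrier G" and m: "m \<in> component g"
  shows "\<exists>t \<in> component g \<cdot>\<^bsub>L\<^esub> component (inv\<^bsub>G\<^esub> g). t \<otimes>\<^bsub>L\<^esub> m = m"
    and "\<exists>u \<in> component (inv\<^bsub>G\<^esub> g) \<cdot>\<^bsub>L\<^esub> component g. m \<otimes>\<^bsub>L\<^esub> u = m"
proof -
  interpret L: graded_ring L G component by (rule L_graded_ring)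
  obtain a where a: "a \<in> N" "a \<in> homogeneous g" "m = cls a" using m by (auto simp: component_eq)
  have aF: "a \<in> carrier F" using a by simp
  let ?W = "{w. a w \<noteq> \<zero>\<^bsub>R\<^esub>}"
  have W: "finite ?W" "?W \<subseteq> lists X" "\<And>w. w \<in> ?W \<Longrightarrow> w \<noteq> [] \<and> deg w = g"
    using aF a by (auto simp: free_algebra_carrier_iff N_iff homogeneous_def simp del: in_lists_conv_set)
  have gi: "inv\<^bsub>G\<^esub> g \<in> carrier G" using g by simp
  have TQ: "t \<in> carrier Q" if "t \<in> component h \<cdot>\<^bsub>L\<^esub> component k" "h \<in> carrier G" "k \<in> carrier G" for t h k
  proof -
    have "component h \<cdot>\<^bsub>L\<^esub> component k \<subseteq> cls ` N"
      using L.S.additive_subgroupD(1)[OF L.S.ideal_prod_subgroup[OF component_subgroup component_subgroup]]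
      by simp
    then have "t \<in> cls ` N" using that by blast
    then show ?thesis by auto
  qed
  have coeff: "cls (monomial R (a w) []) \<in> carrier Q" for w
    using free_carrierD(1)[OF aF] by (intro cls.hom_closed R.monomial_closed) auto
  obtain t where t: "t \<in> component g \<cdot>\<^bsub>L\<^esub> component (inv\<^bsub>G\<^esub> g)"
    and tw: "\<And>w. w \<in> ?W \<Longrightarrow> t \<otimes>\<^bsub>Q\<^esub> word_prod w = word_prod w"
    using word_local_unit[OF g W] by blast
  have tQ: "t \<in> carrier Q" using TQ[OF t g gi] .
  have "t \<otimes>\<^bsub>Q\<^esub> cls a = cls a"
    using aF
  proof (induction rule: R.free_algebra_induct)
    case zero
    then show ?case using cls.hom_zero tQ by (simp add: free_algebra_simps)
  next
    case (monomial w)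
    have w: "w \<in> lists X" "w \<in> ?W" using monomial W(2) by auto
    have "t \<otimes>\<^bsub>Q\<^esub> (word_prod w \<otimes>\<^bsub>Q\<^esub> cls (monomial R (a w) [])) = (t \<otimes>\<^bsub>Q\<^esub> word_prod w) \<otimes>\<^bsub>Q\<^esub> cls (monomial R (a w) [])"
      using w tQ coeff by (simp add: Q.m_assoc del: in_lists_conv_set)
    then show ?case
      using tw[OF w(2)] monomial_eq_word_prod_coeff(1)[OF free_carrierD(1)[OF aF] w(1)] by simp
  next
    case (add b c)
    then have "t \<otimes>\<^bsub>Q\<^esub> cls (b \<oplus>\<^bsub>F\<^esub> c) = cls (b \<oplus>\<^bsub>F\<^esub> c)" using tQ by (simp add: Q.r_distr)
    then show ?case by (simp add: free_algebra_simps)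
  qed
  then show "\<exists>t \<in> component g \<cdot>\<^bsub>L\<^esub> component (inv\<^bsub>G\<^esub> g). t \<otimes>\<^bsub>L\<^esub> m = m"
    using t a(3) by auto
  have W': "finite (word_adjoint ` ?W)" "word_adjoint ` ?W \<subseteq> lists X"
    by (rule finite_imageI[OF W(1)])
      (rule image_subsetI, rule word_adjoint_in_lists, erule subsetD[OF W(2)])
  have W'': "w \<noteq> [] \<and> deg w = inv\<^bsub>G\<^esub> g" if "w \<in> word_adjoint ` ?W" for w
  proof -
    obtain v where v: "v \<in> ?W" "w = word_adjoint v" using \<open>w \<in> _\<close> by blast
    then have "v \<in> lists X" using W(2) by blast
    then show ?thesis using v W(3)[OF v(1)] by (simp add: deg_adjoint)
  qed
  obtain u where u: "u \<in> component (inv\<^bsub>G\<^esub> g) \<cdot>\<^bsub>L\<^esub> component g"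
    and uw: "\<And>w. w \<in> ?W \<Longrightarrow> word_prod w \<otimes>\<^bsub>Q\<^esub> u = word_prod w"
    using word_local_unit[OF gi W' W''] g by auto
  have uQ: "u \<in> carrier Q" using TQ[OF u gi g] .
  have "cls a \<otimes>\<^bsub>Q\<^esub> u = cls a"
    using aF
  proof (induction rule: R.free_algebra_induct)
    case zero
    then show ?case using cls.hom_zero uQ by (simp add: free_algebra_simps)
  next
    case (monomial w)
    have w: "w \<in> lists X" "w \<in> ?W" using monomial W(2) by auto
    have "(cls (monomial R (a w) []) \<otimes>\<^bsub>Q\<^esub> word_prod w) \<otimes>\<^bsub>Q\<^esub> u = cls (monomial R (a w) []) \<otimes>\<^bsub>Q\<^esub> (word_prod w \<otimes>\<^bsub>Q\<^esub> u)"
      using w uQ coeff by (simp add: Q.m_assoc del: in_lists_conv_set)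
    then show ?case
      using uw[OF w(2)] monomial_eq_word_prod_coeff(2)[OF free_carrierD(1)[OF aF] w(1)] by simp
  next
    case (add b c)
    then have "cls (b \<oplus>\<^bsub>F\<^esub> c) \<otimes>\<^bsub>Q\<^esub> u = cls (b \<oplus>\<^bsub>F\<^esub> c)" using uQ by (simp add: Q.l_distr)
    then show ?case by (simp add: free_algebra_simps)
  qed
  then show "\<exists>u \<in> component (inv\<^bsub>G\<^esub> g) \<cdot>\<^bsub>L\<^esub> component g. m \<otimes>\<^bsub>L\<^esub> u = m"
    using u a(3) by auto
qed

end

theorem theorem30:
  fixes R :: "('r, 'm) ring_scheme"
    and G :: "('g, 'n) monoid_scheme"
    and E :: "('v, 'e) pre_digraph"
    and d :: "'e \<Rightarrow> 'g"
  assumes "ring R"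
    and "group G"
    and "wf_digraph E"
    and "d \<in> arcs E \<rightarrow> carrier G"
  shows "nearly_epsilon_strongly_graded (leavitt_path_algebra R E) G (standard_gradation R E G d)"
proof -
  interpret leavitt_grading R G E d
    by (intro leavitt_grading.intro leavitt_grading_axioms.intro assms)
  show ?thesis
    using component_local_units by (intro graded_ring.nearly_epsilon_strongly_gradedI[OF L_graded_ring])
qed

end
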